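(* Let $m\ge1$ be an integer, let $(\mathcal M,+,0)$ be a commutative monoid, and let $S=(s_i)_{i\ge1}$ be a sequence in $\mathcal M$ with $s_{i+m}=s_i$ for all $i\ge1$. Put $S_i=s_1+\cdots+s_i$. Let $c_1,\dots,c_{m-1},c_{\overline1},\dots,c_{\overline m}$ be commuting indeterminates (and set $c_m=1$). Then \begin{align*} \sum_{\lambda\in \overline{\mathcal{P}}_m} \left(\prod_{j=1}^{m-1} c_j^{\rho_j(\lambda)}c_{\overline{j}}^{\rho_{\overline{j}}(\lambda)} \right) c_{\overline{m}}^{\rho_{\overline{m}}(\lambda)} q^{|\lambda|_S} &= \frac{(-c_{\overline{1}} q^{S_1},\ldots,-c_{\overline{m}} q^{S_m};q^{S_m})_\infty}{(c_{1} q^{S_1},\ldots,c_{m-1} q^{S_{m-1}};q^{S_m})_\infty},\\ \sum_{\lambda\in \mathcal{P}_m} \left(\prod_{j=1}^{m-1} c_j^{\rho_j(\lambda)} \right) q^{|\lambda|_S} &= \frac{1}{(c_{1} q^{S_1},\ldots,c_{m-1} q^{S_{m-1}};q^{S_m})_\infty},\\ \sum_{\lambda\in \overline{\mathcal{F}}_m} \left(\prod_{j=1}^m c_{\overline{j}}^{\rho_{\overline{j}}(\lambda)} \right)q^{|\lambda|_S} &= (-c_{\overline{1}} q^{S_1},\ldots,-c_{\overline{m}} q^{S_m};q^{S_m})_\infty. \end{align*}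
   Context: Over-lined integers: $\overline{\mathbb{Z}_{\geq 1}}=\{\overline1,\overline2,\ldots\}$ is a disjoint copy of $\mathbb{Z}_{\ge 1}$; both $i$ and $\overline i$ have size $i$; sums, differences and multiples use sizes. Order: $0<\overline1<1<\overline2<2<\cdots$. An over-partition is an infinite non-increasing sequence $\lambda=(\lambda_i)_{i\ge1}$ of elements of $\mathbb{Z}_{\geq 0}\sqcup\overline{\mathbb{Z}_{\geq 1}}$ with finitely many nonzero terms, in which each over-lined integer occurs at most once. Write $\chi(A)=1$ if $A$ is true and $0$ otherwise. $\overline{\mathcal P}_m$: over-partitions in which every positive integer has fewer than $m$ non-over-lined occurrences. $\mathcal P_m$: elements of $\overline{\mathcal P}_m$ without over-lined parts. $\overline{\mathcal F}_m$: elements $\lambda$ of $\overline{\mathcal P}_m$ such that $\lambda_i-\lambda_{i+1}=\chi(\lambda_i\text{ is over-lined})$ for all $i\ge1$ not divisible by $m$. $|\lambda|_S=\sum_{i\ge1}\lambda_i\cdot s_i\in\mathcal M$. For $1\le j\le m$, $$\rho_j(\lambda)=\sum_{i\ge0}\bigl(\lambda_{j+im}-\lambda_{j+1+im}-\chi(\lambda_{j+im}\text{ is over-lined})\bigr),\qquad \rho_{\overline j}(\lambda)=\#\{i\ge0:\lambda_{j+im}\text{ is over-lined}\}.$$ $q^a$ ($a\in\mathcal M$) are formal powers with $q^aq^b=q^{a+b}$, $q^0=1$. $(a;q^{s})_\infty=\prod_{k\ge0}(1-a\,q^{k\cdot s})$ and $(a_1,\dots,a_j;q^s)_\infty=(a_1;q^s)_\infty\cdots(a_j;q^s)_\infty$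 (equal to $1$ when $j=0$). Identities are identities of formal series in the colors and formal powers of $q$; they are understood in the situation where the sums make sense, i.e. for each color monomial and each $a\in\mathcal M$ only finitely many $\lambda$ in the sum on the left contribute to the coefficient of that monomial times $q^a$. *)

theory Defs
  imports Complex_Main "HOL-Library.Poly_Mapping" "HOL-Library.Product_Plus" "HOL-Library.FuncSet"
begin

section \<open>Over-partitions\<close>

text \<open>
  The type has a spurious element \<open>Over 0\<close>; it is excluded by \<open>parts\<close>.
\<close>

datatype part = Num nat | Over nat

fun psize :: "part \<Rightarrow> nat" where
  "psize (Num n) = n"
| "psize (Over n) = n"

fun is_over :: "part \<Rightarrow> bool" where
  "is_over (Num n) = False"
| "is_over (Over n) = True"

text \<open>\<open>Num 0 < Over 1 < Num 1 < Over 2 < Num 2 < \<dots>\<close>\<close>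

instantiation part :: linorder
begin

definition less_eq_part :: "part \<Rightarrow> part \<Rightarrow> bool" where
  "x \<le> y \<longleftrightarrow> psize x < psize y \<or> psize x = psize y \<and> (is_over x \<or> \<not> is_over y)"

definition less_part :: "part \<Rightarrow> part \<Rightarrow> bool" where
  "x < y \<longleftrightarrow> psize x < psize y \<or> psize x = psize y \<and> is_over x \<and> \<not> is_over y"

instance
proof
  fix x y :: part
  show "x \<le> y \<Longrightarrow> y \<le> x \<Longrightarrow> x = y"
    by (cases x; cases y) (auto simp: less_eq_part_def)
qed (auto simp: less_eq_part_def less_part_def)

end

definition parts :: "part set" where
  "parts = range Num \<union> Over ` {1..}"

text \<open>
  Sequences are indexed from 1. Extensionality fixes the meaningless value at index 0, so that
  every over-partition is represented by exactly one function.
\<close>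

definition overpartitions :: "(nat \<Rightarrow> part) set" where
  "overpartitions = {l \<in> {1..} \<rightarrow>\<^sub>E parts.
     antimono_on {1..} l \<and>
     finite {i. 1 \<le> i \<and> l i \<noteq> Num 0} \<and>
     (\<forall>i\<ge>1. \<forall>j\<ge>1. is_over (l i) \<and> l i = l j \<longrightarrow> i = j)}"

definition Pbar :: "nat \<Rightarrow> (nat \<Rightarrow> part) set" where
  "Pbar m = {l \<in> overpartitions. \<forall>n\<ge>1. card {i. 1 \<le> i \<and> l i = Num n} < m}"

definition Pset :: "nat \<Rightarrow> (nat \<Rightarrow> part) set" where
  "Pset m = {l \<in> Pbar m. \<forall>i\<ge>1. \<not> is_over (l i)}"

definition Fbar :: "nat \<Rightarrow> (nat \<Rightarrow> part) set" where
  "Fbar m = {l \<in> Pbar m. \<forall>i\<ge>1. \<not> m dvd i \<longrightarrow>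
     int (psize (l i)) - int (psize (l (i + 1))) = of_bool (is_over (l i))}"

definition rho :: "nat \<Rightarrow> nat \<Rightarrow> (nat \<Rightarrow> part) \<Rightarrow> int" where
  "rho m j l = Sum_any (\<lambda>i. int (psize (l (j + i * m))) - int (psize (l (j + 1 + i * m)))
                             - of_bool (is_over (l (j + i * m))))"

definition rhobar :: "nat \<Rightarrow> nat \<Rightarrow> (nat \<Rightarrow> part) \<Rightarrow> nat" where
  "rhobar m j l = card {i. is_over (l (j + i * m))}"

text \<open>
  The summands of \<open>rho\<close> are nonnegative on over-partitions, so nothing is lost when \<open>rho\<close> is
  turned into a natural exponent by \<open>nat\<close>.
\<close>

lemma overpartition_difference_nonneg:
  assumes "l \<in> overpartitions" "1 \<le> i"
  shows "int (psize (l i)) - int (psize (l (i + 1))) - of_bool (is_over (l i)) \<ge> 0"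
proof -
  have anti: "antimono_on {1..} l"
    and once: "\<forall>i\<ge>1. \<forall>j\<ge>1. is_over (l i) \<and> l i = l j \<longrightarrow> i = j"
    using assms(1) by (auto simp: overpartitions_def)
  have le: "l (i + 1) \<le> l i"
    using monotone_onD[OF anti, of i "i + 1"] assms(2) by simp
  have ne: "l (i + 1) \<noteq> l i" if "is_over (l i)"
    using once assms(2) that by (metis add_cancel_right_right le_add1 le_trans one_neq_zero)
  show ?thesis
    using le ne by (cases "l i"; cases "l (i + 1)") (auto simp: less_eq_part_def)
qed

lemma rho_nonneg:
  assumes "l \<in> overpartitions" "1 \<le> j"
  shows "rho m j l \<ge> 0"
  unfolding rho_def Sum_any.expand_set
  using overpartition_difference_nonneg[OF assms(1), of "j + i * m" for i] assms(2)
  by (intro sum_nonneg) (simp add: add.commute add.left_commute)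

section \<open>Weights in a commutative monoid\<close>

definition nmul :: "nat \<Rightarrow> 'a::comm_monoid_add \<Rightarrow> 'a" where
  "nmul k a = (\<Sum>i<k. a)"

definition psum :: "(nat \<Rightarrow> 'a::comm_monoid_add) \<Rightarrow> nat \<Rightarrow> 'a" where
  "psum s i = (\<Sum>k=1..i. s k)"

definition weight :: "(nat \<Rightarrow> 'a::comm_monoid_add) \<Rightarrow> (nat \<Rightarrow> part) \<Rightarrow> 'a" where
  "weight s l = (\<Sum>i | 1 \<le> i \<and> l i \<noteq> Num 0. nmul (psize (l i)) (s i))"

section \<open>Formal series in the colours and formal powers of q\<close>

text \<open>
  A monomial is a pair of a colour monomial and an exponent of \<open>q\<close>. Finite expressions live in the
  monoid algebra of the monomials over the integers, a commutative ring; arbitrary formal series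
  are integer functions on the monomials. The latter do not form a ring for a general monoid
  of \<open>q\<close>-exponents (a coefficient of a product may be an infinite sum), hence products of series
  are introduced as relations that include their well-definedness.
\<close>

datatype colour = C nat | Cbar nat

type_synonym 'a mon = "(colour \<Rightarrow>\<^sub>0 nat) \<times> 'a"
type_synonym 'a qpoly = "'a mon \<Rightarrow>\<^sub>0 int"
type_synonym 'a fseries = "'a mon \<Rightarrow> int"

definition col :: "nat \<Rightarrow> 'a::comm_monoid_add qpoly" where
  "col j = Poly_Mapping.single (Poly_Mapping.single (C j) 1, 0) 1"

definition colbar :: "nat \<Rightarrow> 'a::comm_monoid_add qpoly" where
  "colbar j = Poly_Mapping.single (Poly_Mapping.single (Cbar j) 1, 0) 1"

definition qpow :: "'a::comm_monoid_add \<Rightarrow> 'a qpoly" where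
  "qpow a = Poly_Mapping.single (0, a) 1"

definition fsummable :: "'b set \<Rightarrow> ('b \<Rightarrow> 'a::comm_monoid_add qpoly) \<Rightarrow> bool" where
  "fsummable A f \<longleftrightarrow> (\<forall>t. finite {x \<in> A. Poly_Mapping.lookup (f x) t \<noteq> 0})"

definition fsum :: "'b set \<Rightarrow> ('b \<Rightarrow> 'a::comm_monoid_add qpoly) \<Rightarrow> 'a fseries" where
  "fsum A f = (\<lambda>t. \<Sum>x | x \<in> A \<and> Poly_Mapping.lookup (f x) t \<noteq> 0. Poly_Mapping.lookup (f x) t)"

text \<open>\<open>has_qpoch a s X\<close>: the infinite product of \<open>1 - a q\<^bsup>ks\<^esup>\<close> over \<open>k \<ge> 0\<close> converges to \<open>X\<close>,
  that is, every coefficient of the partial products is eventually that of \<open>X\<close>.\<close>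

definition has_qpoch :: "'a::comm_monoid_add qpoly \<Rightarrow> 'a \<Rightarrow> 'a fseries \<Rightarrow> bool" where
  "has_qpoch a s X \<longleftrightarrow>
     (\<forall>t. \<forall>\<^sub>F n in sequentially. Poly_Mapping.lookup (\<Prod>k<n. 1 - a * qpow (nmul k s)) t = X t)"

definition fone :: "'a::comm_monoid_add fseries" where
  "fone = Poly_Mapping.lookup 1"

text \<open>
  The ways to write \<open>t\<close> as a product of one monomial from the support of each series in \<open>Xs\<close>.
\<close>

definition factorizations :: "'a::comm_monoid_add fseries list \<Rightarrow> 'a mon \<Rightarrow> 'a mon list set" where
  "factorizations Xs t = {us. list_all2 (\<lambda>X u. X u \<noteq> 0) Xs us \<and> sum_list us = t}"

definition has_fprod :: "'a::comm_monoid_add fseries list \<Rightarrow> 'a fseries \<Rightarrow> bool" where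
  "has_fprod Xs Z \<longleftrightarrow>
     (\<forall>t. finite (factorizations Xs t) \<and>
          Z t = (\<Sum>us \<in> factorizations Xs t. prod_list (map2 (\<lambda>X u. X u) Xs us)))"

text \<open>\<open>has_qpochs [a\<^sub>1, \<dots>, a\<^sub>j] s X\<close>: the product of the \<open>(a\<^sub>i; q\<^sup>s)\<^sub>\<infinity>\<close> is well-defined and equals \<open>X\<close>.\<close>

definition has_qpochs :: "'a::comm_monoid_add qpoly list \<Rightarrow> 'a \<Rightarrow> 'a fseries \<Rightarrow> bool" where
  "has_qpochs as s X \<longleftrightarrow> (\<exists>Xs. list_all2 (\<lambda>a Y. has_qpoch a s Y) as Xs \<and> has_fprod Xs X)"

text \<open>
  \<open>has_fquot N D Z\<close>: \<open>Z = N \<cdot> D\<^sup>-\<^sup>1\<close>. The inverse \<open>E\<close> is unique whenever the colour-free part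
  of \<open>D\<close> is 1 (recursion on the degree in the colours), as it is for the products of
  factors \<open>1 - c q\<^sup>b\<close> considered here.
\<close>

definition has_fquot ::
    "'a::comm_monoid_add fseries \<Rightarrow> 'a fseries \<Rightarrow> 'a fseries \<Rightarrow> bool" where
  "has_fquot N D Z \<longleftrightarrow> (\<exists>E. has_fprod [D, E] fone \<and> has_fprod [N, E] Z)"

section \<open>The summands\<close>

definition term_Pbar ::
    "nat \<Rightarrow> (nat \<Rightarrow> 'a::comm_monoid_add) \<Rightarrow> (nat \<Rightarrow> part) \<Rightarrow> 'a qpoly" where
  "term_Pbar m s l =
     (\<Prod>j=1..<m. col j ^ nat (rho m j l) * colbar j ^ rhobar m j l)
       * colbar m ^ rhobar m m l * qpow (weight s l)"

definition term_P ::
    "nat \<Rightarrow> (nat \<Rightarrow> 'a::comm_monoid_add) \<Rightarrow> (nat \<Rightarrow> part) \<Rightarrow> 'a qpoly" where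
  "term_P m s l = (\<Prod>j=1..<m. col j ^ nat (rho m j l)) * qpow (weight s l)"

definition term_F ::
    "nat \<Rightarrow> (nat \<Rightarrow> 'a::comm_monoid_add) \<Rightarrow> (nat \<Rightarrow> part) \<Rightarrow> 'a qpoly" where
  "term_F m s l = (\<Prod>j=1..m. colbar j ^ rhobar m j l) * qpow (weight s l)"

end

theory Submission
  imports Defs "HOL-Library.Multiset"
begin

text \<open>
  An over-partition is determined by the multiset of parts of its conjugate, where a part \<open>i\<close> of the
  conjugate is over-lined if \<open>\<lambda>\<^sub>i\<close> is; in these terms the summand of an over-partition is the product,
  over the parts of the conjugate, of \<open>c\<^sub>j q\<^bsup>S\<^sub>i\<^esup>\<close> with \<open>j \<equiv> i\<close> modulo \<open>m\<close>.
  Inserting \<open>m\<close> further copies of a part \<open>n\<close> into \<open>\<lambda>\<close> adds \<open>m\<close> to each of the first \<open>n\<close> parts of the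
  conjugate, so it only multiplies the summand by \<open>q\<close> to the power \<open>n S\<^sub>m\<close>; inserting the part
  \<open>mn\<close> into the conjugate has the same effect. Hence the over-partitions with fewer than \<open>m\<close>
  non-over-lined occurrences of each size, and those whose conjugate has no non-over-lined part
  divisible by \<open>m\<close>, both yield the generating function of all over-partitions after multiplication
  by the same factor. Cancelling it, on the level of cardinalities, gives a bijection between the two
  families which preserves summands. The products on the right-hand sides enumerate the second family.
  The other two identities are the restrictions of this bijection to conjugates without over-lined and
  without non-over-lined parts.
\<close>

section \<open>Multisets of parts and conjugation\<close>

text \<open>The cancellation cannot be carried out with series over the given monoid. Summability is
  known only for the left-hand side of an identity; the series of all over-partitions and the common
  factor need not exist (if \<open>psum s m = 0\<close>, every choice of inserted parts contributes
  to the same coefficient of that factor). Hence the argument runs before \<open>s\<close> enters: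
  the statistics \<open>letters\<close> and \<open>wraps\<close> depend on \<open>m\<close> alone,
  their joint fibres are finite, and for every periodic \<open>s\<close> the monomial of a multiset
  is a function of the two. The resulting bijection is not explicit, being chosen fibre by fibre. As
  \<open>letters\<close> also shows whether over-lined parts, or non-over-lined parts not divisible
  by \<open>m\<close>, occur, one bijection serves all three identities.

  The right-hand sides meet the same obstacle. They are expanded as integer weights on multisets of
  parts, where convolutions are finite sums, and then transported by \<open>push\<close>; the
  finiteness required for this comes from the summability of the left-hand side through the
  bijection.\<close>

lemma finite_multisets_bounded:
  assumes "finite A"
  shows "finite {X. set_mset X \<subseteq> A \<and> size X \<le> n}"
proof (rule finite_subset)
  show "{X. set_mset X \<subseteq> A \<and> size X \<le> n} \<subseteq> mset ` {xs. set xs \<subseteq> A \<and> length xs \<le> n}"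
  proof
    fix X assume X: "X \<in> {X. set_mset X \<subseteq> A \<and> size X \<le> n}"
    obtain xs where "mset xs = X" using ex_mset by blast
    with X show "X \<in> mset ` {xs. set xs \<subseteq> A \<and> length xs \<le> n}" by (auto intro!: image_eqI[of _ _ xs])
  qed
  show "finite (mset ` {xs. set xs \<subseteq> A \<and> length xs \<le> n})"
    using finite_lists_length_le[OF assms] by simp
qed

text \<open>Finite multisets avoid the tail of zeros of a sequence. Positivity of sizes excludes
  \<open>Num 0\<close> as well as the spurious \<open>Over 0\<close>.\<close>

definition omsets :: "part multiset set" where
  "omsets = {X. (\<forall>p\<in>#X. 0 < psize p) \<and> (\<forall>n. count X (Over n) \<le> 1)}"

definition num_ge :: "part multiset \<Rightarrow> nat \<Rightarrow> nat" where
  "num_ge X n = size {#p \<in># X. n \<le> psize p#}"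

text \<open>An over-lined entry is the last of its size, so its mark sits at a corner of the Ferrers
  diagram. Transposition takes corners to corners, which is why the mark of entry \<open>n\<close>
  is recorded by the part \<open>Over n\<close>. The restriction to \<open>{1..}\<close> yields the
  value at index 0 that extensionality demands.\<close>

definition conjugate :: "part multiset \<Rightarrow> nat \<Rightarrow> part" where
  "conjugate X = (\<lambda>n\<in>{1..}. if Over n \<in># X then Over (num_ge X n) else Num (num_ge X n))"

definition vals :: "(nat \<Rightarrow> part) \<Rightarrow> part multiset" where
  "vals l = image_mset l (mset_set {i. 1 \<le> i \<and> l i \<noteq> Num 0})"

abbreviation star :: "part multiset \<Rightarrow> part multiset" where
  "star X \<equiv> vals (conjugate X)"

lemma part_cases_psize: "p = Num (psize p) \<or> p = Over (psize p)"
  by (cases p) auto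

lemma omsets_pos: "X \<in> omsets \<Longrightarrow> p \<in># X \<Longrightarrow> 0 < psize p"
  by (auto simp: omsets_def)

lemma omsets_count_Over: "X \<in> omsets \<Longrightarrow> count X (Over n) = of_bool (Over n \<in># X)"
proof -
  assume "X \<in> omsets"
  then have "count X (Over n) \<le> 1"
    by (simp add: omsets_def)
  then show ?thesis
    by (cases "Over n \<in># X") (simp_all add: not_in_iff le_antisym Suc_leI)
qed

lemma num_ge_Suc: "num_ge X n = num_ge X (Suc n) + count X (Num n) + count X (Over n)"
proof (induction X)
  case empty
  show ?case by (simp add: num_ge_def)
next
  case (add p X)
  then show ?case by (cases p) (auto simp: num_ge_def)
qed

text \<open>Read for the sequence \<open>conjugate X\<close>, this recurrence identifies each
  summand of \<open>rho\<close> with a multiplicity \<open>count X (Num n)\<close>.\<close>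

lemma num_ge_Suc_omset:
  "X \<in> omsets \<Longrightarrow> num_ge X n = num_ge X (Suc n) + count X (Num n) + of_bool (Over n \<in># X)"
  using num_ge_Suc[of X n] omsets_count_Over[of X n] by simp

lemma num_ge_eq_0_iff: "num_ge X n = 0 \<longleftrightarrow> (\<forall>p\<in>#X. psize p < n)"
  by (induction X) (auto simp: num_ge_def)

lemma num_ge_antimono: "i \<le> j \<Longrightarrow> num_ge X j \<le> num_ge X i"
proof (induction rule: dec_induct)
  case (step n)
  then show ?case using num_ge_Suc[of X n] by linarith
qed simp

lemma num_ge_eventually_zero:
  obtains N where "\<And>n. N < n \<Longrightarrow> num_ge X n = 0"
proof
  fix n assume "sum_mset (image_mset psize X) < n"
  moreover have "psize p \<le> sum_mset (image_mset psize X)" if "p \<in># X" for p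
    using that by (metis image_mset_add_mset le_add1 multi_member_split sum_mset.insert)
  ultimately show "num_ge X n = 0"
    by (fastforce simp: num_ge_eq_0_iff)
qed

lemma Over_num_ge_pos: "Over n \<in># X \<Longrightarrow> 0 < num_ge X n"
  using num_ge_eq_0_iff[of X n] by fastforce

lemma psize_conjugate [simp]: "1 \<le> n \<Longrightarrow> psize (conjugate X n) = num_ge X n"
  by (simp add: conjugate_def)

lemma is_over_conjugate [simp]: "1 \<le> n \<Longrightarrow> is_over (conjugate X n) \<longleftrightarrow> Over n \<in># X"
  by (simp add: conjugate_def)

lemma conjugate_eq_Num: "1 \<le> n \<Longrightarrow> conjugate X n = Num k \<longleftrightarrow> num_ge X n = k \<and> Over n \<notin># X"
  by (auto simp: conjugate_def)

lemma conjugate_eq_Over: "1 \<le> n \<Longrightarrow> conjugate X n = Over k \<longleftrightarrow> num_ge X n = k \<and> Over n \<in># X"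
  by (auto simp: conjugate_def)

lemma conjugate_eq_Num0: "1 \<le> n \<Longrightarrow> conjugate X n = Num 0 \<longleftrightarrow> num_ge X n = 0"
  using Over_num_ge_pos[of n X] by (auto simp: conjugate_eq_Num)

lemma finite_conjugate_support: "finite {i. 1 \<le> i \<and> conjugate X i \<noteq> Num 0}"
proof -
  obtain N where "\<And>n. N < n \<Longrightarrow> num_ge X n = 0"
    using num_ge_eventually_zero by blast
  then have "{i. 1 \<le> i \<and> conjugate X i \<noteq> Num 0} \<subseteq> {..N}"
    by (auto simp: conjugate_eq_Num0 intro: leI)
  then show ?thesis
    using finite_subset by blast
qed

text \<open>The size drops immediately after a marked entry. Both the order on \<open>part\<close>
  and the uniqueness of over-lined entries rest on this.\<close>

lemma conjugate_Over_last:
  assumes "X \<in> omsets" "1 \<le> i" "i < j" "Over i \<in># X"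
  shows "num_ge X j < num_ge X i"
proof -
  have "num_ge X j \<le> num_ge X (Suc i)"
    using assms(3) by (intro num_ge_antimono) auto
  also have "\<dots> < num_ge X i"
    using num_ge_Suc_omset[OF assms(1), of i] assms(4) by simp
  finally show ?thesis .
qed

lemma conjugate_in_overpartitions:
  assumes "X \<in> omsets"
  shows "conjugate X \<in> overpartitions"
proof -
  have "conjugate X i \<in> parts" if "1 \<le> i" for i
    using that Over_num_ge_pos[of i X] by (auto simp: conjugate_def parts_def)
  moreover have "conjugate X i = undefined" if "i \<notin> {1..}" for i
    using that by (simp add: conjugate_def)
  moreover have "antimono_on {1..} (conjugate X)"
  proof (rule monotone_onI)
    fix i j :: nat assume ij: "i \<in> {1..}" "j \<in> {1..}" "i \<le> j"
    show "conjugate X j \<le> conjugate X i"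
      using ij num_ge_antimono[OF ij(3), of X] conjugate_Over_last[OF assms, of i j]
      by (cases "i = j") (auto simp: less_eq_part_def)
  qed
  moreover have "\<forall>i\<ge>1. \<forall>j\<ge>1. is_over (conjugate X i) \<and> conjugate X i = conjugate X j \<longrightarrow> i = j"
    using conjugate_Over_last[OF assms]
    by (metis is_over_conjugate less_irrefl linorder_neqE_nat psize_conjugate)
  ultimately show ?thesis
    using finite_conjugate_support[of X]
    by (simp add: overpartitions_def PiE_def extensional_def Pi_def)
qed

lemma conjugate_inj: "inj_on conjugate omsets"
proof (rule inj_onI)
  fix X Y assume X: "X \<in> omsets" and Y: "Y \<in> omsets" and eq: "conjugate X = conjugate Y"
  show "X = Y"
  proof (rule multiset_eqI)
    fix p
    show "count X p = count Y p"
    proof (cases "psize p = 0")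
      case True
      then show ?thesis
        using omsets_pos[OF X, of p] omsets_pos[OF Y, of p] by (metis less_irrefl not_in_iff)
    next
      case False
      define n where "n = psize p"
      have n: "1 \<le> n" using False by (simp add: n_def)
      have g: "num_ge X n = num_ge Y n" "num_ge X (Suc n) = num_ge Y (Suc n)"
        using n psize_conjugate[of n X] psize_conjugate[of n Y] psize_conjugate[of "Suc n" X] psize_conjugate[of "Suc n" Y]
        by (simp_all add: eq)
      have o: "Over n \<in># X \<longleftrightarrow> Over n \<in># Y"
        using n is_over_conjugate[of n X] is_over_conjugate[of n Y] by (simp add: eq)
      show ?thesis
        using part_cases_psize[of p] g o num_ge_Suc_omset[OF X, of n] num_ge_Suc_omset[OF Y, of n]
          omsets_count_Over[OF X, of n] omsets_count_Over[OF Y, of n]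
        by (auto simp: n_def[symmetric])
    qed
  qed
qed

lemma conjugate_surj:
  assumes l: "l \<in> overpartitions"
  shows "\<exists>X\<in>omsets. conjugate X = l"
proof -
  \<comment> \<open>By \<open>num_ge_Suc_omset\<close> a preimage must contain \<open>Num i\<close>
    exactly \<open>d i\<close> times and \<open>Over i\<close> exactly when \<open>l i\<close> is
    over-lined. Nothing is lost by \<open>nat\<close>, because of
    \<open>overpartition_difference_nonneg\<close>.\<close>
  define d where "d i = nat (int (psize (l i)) - int (psize (l (i + 1))) - of_bool (is_over (l i)))" for i
  define c where "c p = (if psize p = 0 then 0 else if is_over p then of_bool (is_over (l (psize p)))
    else d (psize p))" for p
  have fin: "finite {i. 1 \<le> i \<and> l i \<noteq> Num 0}"
    and ext: "l \<in> extensional {1..}" and prt: "\<And>i. 1 \<le> i \<Longrightarrow> l i \<in> parts"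
    using l by (auto simp: overpartitions_def PiE_def)
  obtain N where N0: "\<forall>i\<in>{i. 1 \<le> i \<and> l i \<noteq> Num 0}. i \<le> N"
    using fin finite_nat_set_iff_bounded_le by blast
  have N: "l i = Num 0" if "N < i" for i
    using N0 that by (metis (mono_tags, lifting) leD less_one linorder_not_less mem_Collect_eq not_less_zero order_less_le_trans)
  have step: "psize (l i) = psize (l (Suc i)) + d i + of_bool (is_over (l i))" if "1 \<le> i" for i
    using overpartition_difference_nonneg[OF l that] by (cases "is_over (l i)") (simp_all add: d_def)
  have "finite {p. 0 < c p}"
  proof (rule finite_subset)
    show "{p. 0 < c p} \<subseteq> Num ` {..N} \<union> Over ` {..N}"
    proof
      fix p assume p: "p \<in> {p. 0 < c p}"
      then have "psize p \<le> N"
        using N[of "psize p"] N[of "psize p + 1"] by (force simp: c_def d_def intro: leI split: if_splits)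
      then show "p \<in> Num ` {..N} \<union> Over ` {..N}"
        by (cases p) auto
    qed
  qed auto
  then have cnt: "count (Abs_multiset c) = c"
    by simp
  define X where "X = Abs_multiset c"
  have X: "X \<in> omsets"
    by (auto simp: omsets_def X_def cnt c_def simp flip: count_greater_zero_iff split: if_splits)
  have Over: "Over i \<in># X \<longleftrightarrow> is_over (l i)" if "1 \<le> i" for i
    using that by (simp add: X_def cnt c_def flip: count_greater_zero_iff)
  \<comment> \<open>Both sides obey the same recurrence from \<open>Suc i\<close> to
    \<open>i\<close> and vanish beyond \<open>N\<close>, so the induction descends from
    \<open>Suc N\<close>.\<close>
  have ge: "num_ge X i = psize (l i)" if "1 \<le> i" for i
  proof (cases "i \<le> Suc N")
    case True
    then show ?thesis using that
    proof (induction i rule: inc_induct)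
      case base
      have "psize p \<le> N" if "p \<in># X" for p
        using that N[of "psize p"] N[of "psize p + 1"]
        by (force simp: X_def cnt c_def d_def intro: leI simp flip: count_greater_zero_iff split: if_splits)
      then have "num_ge X (Suc N) = 0"
        by (fastforce simp: num_ge_eq_0_iff)
      then show ?case using N[of "Suc N"] by simp
    next
      case (step i)
      then show ?case
        using num_ge_Suc_omset[OF X, of i] \<open>\<And>i. 1 \<le> i \<Longrightarrow> psize (l i) = _\<close>[of i] Over[of i]
        by (simp add: X_def cnt c_def)
    qed
  next
    case False
    have "psize p \<le> N" if "p \<in># X" for p
      using that N[of "psize p"] N[of "psize p + 1"]
      by (force simp: X_def cnt c_def d_def intro: leI simp flip: count_greater_zero_iff split: if_splits)
    then have "num_ge X i = 0"
      using False by (fastforce simp: num_ge_eq_0_iff)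
    then show ?thesis using N[of i] False by simp
  qed
  have "conjugate X i = l i" for i
  proof (cases "1 \<le> i")
    case True
    then show ?thesis
      using ge[OF True] Over[OF True] by (cases "l i") (auto simp: conjugate_def)
  next
    case False
    then show ?thesis using ext by (auto simp: conjugate_def extensional_def)
  qed
  then show ?thesis
    using X by blast
qed

section \<open>Conjugation as an involution on multisets\<close>

lemma count_vals:
  assumes "p \<noteq> Num 0" "finite {i. 1 \<le> i \<and> l i \<noteq> Num 0}"
  shows "count (vals l) p = card {i. 1 \<le> i \<and> l i = p}"
proof -
  have "count (vals l) p = card {i \<in> {i. 1 \<le> i \<and> l i \<noteq> Num 0}. l i = p}"
    unfolding vals_def count_image_mset' card_eq_sum
    using assms(2) by (intro sum.cong) auto
  also have "{i \<in> {i. 1 \<le> i \<and> l i \<noteq> Num 0}. l i = p} = {i. 1 \<le> i \<and> l i = p}"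
    using assms(1) by auto
  finally show ?thesis .
qed

lemma count_star: "p \<noteq> Num 0 \<Longrightarrow> count (star X) p = card {i. 1 \<le> i \<and> conjugate X i = p}"
  by (rule count_vals) (use finite_conjugate_support in auto)

lemma in_star_iff: "p \<in># star X \<longleftrightarrow> p \<noteq> Num 0 \<and> (\<exists>i\<ge>1. conjugate X i = p)"
  using finite_conjugate_support[of X] by (auto simp: vals_def)

lemma star_in_omsets:
  assumes "X \<in> omsets"
  shows "star X \<in> omsets"
proof -
  have "0 < psize p" if "p \<in># star X" for p
    using that by (auto simp: in_star_iff conjugate_eq_Num0)
  moreover have "count (star X) (Over n) \<le> 1" for n
  proof -
    have "i = j" if "1 \<le> i" "conjugate X i = Over n" "1 \<le> j" "conjugate X j = Over n" for i j
      using conjugate_in_overpartitions[OF assms] that is_over.simps(2)[of n]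
      unfolding overpartitions_def mem_Collect_eq by metis
    then have "card {i. 1 \<le> i \<and> conjugate X i = Over n} \<le> 1"
      using card_le_Suc0_iff_eq[of "{i. 1 \<le> i \<and> conjugate X i = Over n}"]
      by (cases "finite {i. 1 \<le> i \<and> conjugate X i = Over n}") auto
    then show ?thesis by (simp add: count_star)
  qed
  ultimately show ?thesis by (simp add: omsets_def)
qed

lemma num_ge_star:
  assumes "1 \<le> n"
  shows "num_ge (star X) n = card {k. 1 \<le> k \<and> n \<le> num_ge X k}"
proof -
  have "num_ge (star X) n = card {k \<in> {i. 1 \<le> i \<and> conjugate X i \<noteq> Num 0}. n \<le> psize (conjugate X k)}"
    using finite_conjugate_support[of X]
    by (simp add: num_ge_def vals_def filter_mset_image_mset filter_mset_mset_set)
  also have "{k \<in> {i. 1 \<le> i \<and> conjugate X i \<noteq> Num 0}. n \<le> psize (conjugate X k)}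
      = {k. 1 \<le> k \<and> n \<le> num_ge X k}"
    using assms by (auto simp: conjugate_eq_Num0)
  finally show ?thesis .
qed

lemma down_closed_eq_atLeastAtMost_card:
  fixes T :: "nat set"
  assumes "finite T" "0 \<notin> T" "\<And>j k. k \<in> T \<Longrightarrow> 1 \<le> j \<Longrightarrow> j \<le> k \<Longrightarrow> j \<in> T"
  shows "T = {1..card T}"
proof (cases "T = {}")
  case False
  have "T = {1..Max T}"
  proof
    show "T \<subseteq> {1..Max T}"
      using assms(1,2) by (auto simp: Suc_le_eq intro: gr0I)
    show "{1..Max T} \<subseteq> T"
      using assms(3)[of "Max T"] assms(1) False by auto
  qed
  then show ?thesis
    by (metis card_atLeastAtMost diff_Suc_1 One_nat_def)
qed simp

text \<open>Transposition of a Ferrers diagram: \<open>num_ge X\<close> is antitone, so the indices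
  \<open>k \<ge> 1\<close> with \<open>n \<le> num_ge X k\<close> form an initial segment, whose
  length is \<open>num_ge (star X) n\<close>.\<close>

lemma le_num_ge_star_iff:
  assumes "1 \<le> i" "1 \<le> n"
  shows "i \<le> num_ge (star X) n \<longleftrightarrow> n \<le> num_ge X i"
proof -
  define T where "T = {k. 1 \<le> k \<and> n \<le> num_ge X k}"
  have "T \<subseteq> {i. 1 \<le> i \<and> conjugate X i \<noteq> Num 0}"
    using assms(2) by (auto simp: T_def conjugate_eq_Num0)
  then have "finite T"
    using finite_conjugate_support finite_subset by blast
  then have "T = {1..card T}"
    using num_ge_antimono[of _ _ X] by (intro down_closed_eq_atLeastAtMost_card) (auto simp: T_def intro: order_trans)
  then have "i \<in> T \<longleftrightarrow> i \<le> card T"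
    using assms(1) by (metis atLeastAtMost_iff)
  then show ?thesis
    using assms by (simp add: num_ge_star T_def)
qed

lemma num_ge_star_eq_iff:
  assumes "1 \<le> i" "1 \<le> n"
  shows "num_ge (star X) n = i \<longleftrightarrow> num_ge X (Suc i) < n \<and> n \<le> num_ge X i"
  using le_num_ge_star_iff[OF assms, of X] le_num_ge_star_iff[of "Suc i" n X] assms by auto

text \<open>Both sides describe a marked corner in row \<open>i\<close> and column \<open>n\<close>.
  The mark makes \<open>num_ge X\<close> drop directly after \<open>i\<close>, so column
  \<open>n\<close> ends there.\<close>

lemma Over_star_iff:
  assumes "X \<in> omsets" "1 \<le> i" "1 \<le> n"
  shows "Over n \<in># star X \<and> num_ge (star X) n = i \<longleftrightarrow> num_ge X i = n \<and> Over i \<in># X"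
proof -
  have *: "num_ge (star X) n = k" if "1 \<le> k" "num_ge X k = n" "Over k \<in># X" for k
    using that assms(3) num_ge_Suc_omset[OF assms(1), of k] by (simp add: num_ge_star_eq_iff)
  have "Over n \<in># star X \<longleftrightarrow> (\<exists>k\<ge>1. num_ge X k = n \<and> Over k \<in># X)"
    by (auto simp: in_star_iff conjugate_eq_Over)
  then show ?thesis
    using * assms(2) by metis
qed

lemma star_star:
  assumes X: "X \<in> omsets"
  shows "star (star X) = X"
proof (rule multiset_eqI)
  fix p
  note sX = star_in_omsets[OF X]
  show "count (star (star X)) p = count X p"
  proof (cases "psize p = 0")
    case True
    then show ?thesis
      using omsets_pos[OF X, of p] omsets_pos[OF star_in_omsets[OF sX], of p] by (metis less_irrefl not_in_iff)
  next
    case False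
    define i where "i = psize p"
    have i: "1 \<le> i" using False by (simp add: i_def)
    have "{n. 1 \<le> n \<and> conjugate (star X) n = Over i} = {n. 1 \<le> n \<and> num_ge X i = n \<and> Over i \<in># X}"
      by (rule Collect_cong) (metis Over_star_iff[OF X i] conjugate_eq_Over)
    also have "\<dots> = (if Over i \<in># X then {num_ge X i} else {})"
      using Over_num_ge_pos[of i X] by auto
    finally have over: "card {n. 1 \<le> n \<and> conjugate (star X) n = Over i} = of_bool (Over i \<in># X)"
      by simp
    \<comment> \<open>The entries of size \<open>i\<close> occupy the positions between
      \<open>num_ge X (Suc i)\<close> and \<open>num_ge X i\<close>. If \<open>Over i\<close> occurs
      in \<open>X\<close>, the last of these positions carries the mark and is removed.\<close>
    have "{n. 1 \<le> n \<and> conjugate (star X) n = Num i} =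
        {n. 1 \<le> n \<and> (num_ge X (Suc i) < n \<and> n \<le> num_ge X i) \<and> \<not> (num_ge X i = n \<and> Over i \<in># X)}"
      by (rule Collect_cong) (metis Over_star_iff[OF X i] num_ge_star_eq_iff[OF i] conjugate_eq_Num)
    also have "\<dots> = {num_ge X (Suc i)<..num_ge X i} - (if Over i \<in># X then {num_ge X i} else {})"
      by auto
    finally have "{n. 1 \<le> n \<and> conjugate (star X) n = Num i}
      = {num_ge X (Suc i)<..num_ge X i} - (if Over i \<in># X then {num_ge X i} else {})" .
    then have "card {n. 1 \<le> n \<and> conjugate (star X) n = Num i} = count X (Num i)"
      using num_ge_Suc_omset[OF X, of i] by (auto simp: card_Diff_singleton_if)
    then show ?thesis
      using part_cases_psize[of p] over i omsets_count_Over[OF X, of i]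
      by (auto simp: count_star i_def[symmetric])
  qed
qed

lemma bij_betw_star: "bij_betw (\<lambda>X. star X) omsets omsets"
  by (rule bij_betw_byWitness[where f' = "\<lambda>X. star X"]) (auto simp: star_star star_in_omsets)

text \<open>By \<open>star_star\<close>, \<open>conjugate (star V)\<close> is the sequence with
  \<open>V\<close> as its multiset of nonzero entries, so the bound on repetitions becomes a bound
  on multiplicities.\<close>

lemma image_conjugate_star_Pbar:
  "Pbar m = (\<lambda>V. conjugate (star V)) ` {V \<in> omsets. \<forall>n\<ge>1. count V (Num n) < m}"
proof -
  have P: "conjugate X \<in> Pbar m \<longleftrightarrow> (\<forall>n\<ge>1. count (star X) (Num n) < m)" if "X \<in> omsets" for X
    using that by (auto simp: Pbar_def conjugate_in_overpartitions count_star)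
  show ?thesis
  proof (intro set_eqI iffI)
    fix l assume "l \<in> Pbar m"
    then obtain X where X: "X \<in> omsets" "conjugate X = l"
      using conjugate_surj[of l] by (auto simp: Pbar_def)
    have "star X \<in> {V \<in> omsets. \<forall>n\<ge>1. count V (Num n) < m}"
      using P[OF X(1)] X \<open>l \<in> Pbar m\<close> star_in_omsets[OF X(1)] by simp
    moreover have "l = conjugate (star (star X))"
      by (metis X star_star)
    ultimately show "l \<in> (\<lambda>V. conjugate (star V)) ` {V \<in> omsets. \<forall>n\<ge>1. count V (Num n) < m}"
      by (rule image_eqI[rotated])
  next
    fix l assume "l \<in> (\<lambda>V. conjugate (star V)) ` {V \<in> omsets. \<forall>n\<ge>1. count V (Num n) < m}"
    then show "l \<in> Pbar m"
      using P star_in_omsets by (auto simp: star_star)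
  qed
qed

section \<open>Residues and quotients modulo \<open>m\<close>\<close>

definition letter :: "nat \<Rightarrow> part \<Rightarrow> part" where
  "letter m p = (if is_over p then Over (psize p mod m) else Num (psize p mod m))"

text \<open>Non-over-lined multiples of \<open>m\<close> carry the colour \<open>c_m = 1\<close> and
  are dropped. \<open>Over 0\<close> stays: it stands for the over-lined multiples of
  \<open>m\<close>, whose colour is \<open>Cbar m\<close>.\<close>

definition letters :: "nat \<Rightarrow> part multiset \<Rightarrow> part multiset" where
  "letters m X = {#q \<in># image_mset (letter m) X. q \<noteq> Num 0#}"

definition wraps :: "nat \<Rightarrow> part multiset \<Rightarrow> nat" where
  "wraps m X = (\<Sum>p\<in>#X. psize p div m)"

definition copies :: "nat \<Rightarrow> nat multiset \<Rightarrow> part multiset" where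
  "copies m Y = repeat_mset m (image_mset Num Y)"

lemma num_ge_plus [simp]: "num_ge (X + Y) n = num_ge X n + num_ge Y n"
  by (simp add: num_ge_def)

lemma num_ge_copies: "num_ge (copies m Y) n = m * size {#y \<in># Y. n \<le> y#}"
proof (induction Y)
  case (add y Y)
  have "num_ge (copies m (add_mset y Y)) n = num_ge (replicate_mset m (Num y)) n + num_ge (copies m Y) n"
    unfolding num_ge_plus[symmetric] copies_def
    by (rule arg_cong[of _ _ "\<lambda>Z. num_ge Z n"]) (auto intro!: multiset_eqI)
  moreover have "num_ge (replicate_mset m (Num y)) n = m * of_bool (n \<le> y)"
    by (induction m) (auto simp: num_ge_def)
  ultimately show ?case using add by simp
qed (simp add: copies_def num_ge_def)

lemma Over_notin_copies [simp]: "Over n \<notin># copies m Y"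
  by (auto simp: copies_def count_image_mset' simp flip: count_greater_zero_iff)

lemma sum_size_ge:
  fixes Y :: "nat multiset"
  assumes "\<forall>y\<in>#Y. y \<le> N"
  shows "(\<Sum>n=1..N. size {#y \<in># Y. n \<le> y#}) = sum_mset Y"
  using assms
proof (induction Y)
  case (add y Y)
  have "(\<Sum>n=1..N. size {#x \<in># add_mset y Y. n \<le> x#})
      = (\<Sum>n=1..N. of_bool (n \<le> y)) + (\<Sum>n=1..N. size {#x \<in># Y. n \<le> x#})"
    unfolding sum.distrib[symmetric] by (rule sum.cong) auto
  moreover have "(\<Sum>n=1..N. of_bool (n \<le> y)) = card ({1..N} \<inter> {n. n \<le> y})"
    by (simp add: Collect_mem_eq)
  moreover have "{1..N} \<inter> {n. n \<le> y} = {1..y}"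
    using add.prems by auto
  ultimately show ?case using add by simp
qed simp

text \<open>One cutoff \<open>N\<close> serves both \<open>V\<close> and
  \<open>V + copies m Y\<close>, so that their conjugates are indexed by the same positions and can
  be compared entry by entry.\<close>

lemma star_eq_bounded:
  assumes "\<forall>n>N. num_ge V n = 0"
  shows "star V = {#q \<in># image_mset (conjugate V) (mset_set {1..N}). q \<noteq> Num 0#}"
proof -
  have "{i. 1 \<le> i \<and> conjugate V i \<noteq> Num 0} = {i \<in> {1..N}. conjugate V i \<noteq> Num 0}"
    using assms by (auto simp: conjugate_eq_Num0 intro: ccontr)
  then show ?thesis
    unfolding vals_def by (simp add: filter_mset_image_mset filter_mset_mset_set)
qed

lemma letters_star:
  assumes "\<forall>n>N. num_ge V n = 0"
  shows "letters m (star V) = {#q \<in># image_mset (\<lambda>n. letter m (conjugate V n)) (mset_set {1..N}). q \<noteq> Num 0#}"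
proof -
  have "letters m {#q \<in># X. q \<noteq> Num 0#} = letters m X" for X
    by (induction X) (auto simp: letters_def letter_def)
  then show ?thesis
    unfolding star_eq_bounded[OF assms] by (simp add: letters_def image_mset.compositionality comp_def)
qed

lemma wraps_star:
  assumes "\<forall>n>N. num_ge V n = 0"
  shows "wraps m (star V) = (\<Sum>n=1..N. num_ge V n div m)"
proof -
  have "wraps m {#q \<in># X. q \<noteq> Num 0#} = wraps m X" for X
    by (induction X) (auto simp: wraps_def)
  then have "wraps m (star V) = (\<Sum>n=1..N. psize (conjugate V n) div m)"
    unfolding star_eq_bounded[OF assms]
    by (simp add: wraps_def image_mset.compositionality comp_def sum_unfold_sum_mset del: psize_conjugate)
  then show ?thesis by simp
qed

text \<open>At position \<open>n\<close> the conjugate grows by \<open>m\<close> times the number of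
  \<open>y \<ge> n\<close> in \<open>Y\<close> and keeps its mark. The residue is unchanged, the
  quotient grows by that number, and these numbers add up to \<open>sum_mset Y\<close>. A zero that
  turns into a positive multiple of \<open>m\<close> is invisible to \<open>letters\<close>, which
  drops \<open>Num 0\<close>.\<close>

lemma stat_star_copies:
  assumes m: "1 \<le> m"
  shows "letters m (star (V + copies m Y)) = letters m (star V)"
    and "wraps m (star (V + copies m Y)) = wraps m (star V) + sum_mset Y"
proof -
  obtain N where N: "\<forall>n>N. num_ge (V + copies m Y) n = 0"
    using num_ge_eventually_zero by metis
  then have NV: "\<forall>n>N. num_ge V n = 0"
    by simp
  have "\<forall>y\<in>#Y. y \<le> N"
  proof (rule ballI, rule ccontr)
    fix y assume "y \<in># Y" "\<not> y \<le> N"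
    then have "{#z \<in># Y. y \<le> z#} = {#}"
      using N[rule_format, of y] m by (simp add: num_ge_copies)
    then show False using \<open>y \<in># Y\<close> by auto
  qed
  then have Y: "(\<Sum>n=1..N. size {#y \<in># Y. n \<le> y#}) = sum_mset Y"
    by (rule sum_size_ge)
  have *: "letter m (conjugate (V + copies m Y) n) = letter m (conjugate V n)" if "1 \<le> n" for n
    using that by (simp add: letter_def num_ge_copies)
  have "image_mset (\<lambda>n. letter m (conjugate (V + copies m Y) n)) (mset_set {1..N})
      = image_mset (\<lambda>n. letter m (conjugate V n)) (mset_set {1..N})"
    by (rule image_mset_cong) (use * in auto)
  then show "letters m (star (V + copies m Y)) = letters m (star V)"
    by (simp only: letters_star[OF N] letters_star[OF NV])
  have "(\<Sum>n=1..N. num_ge (V + copies m Y) n div m)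
      = (\<Sum>n=1..N. num_ge V n div m + size {#y \<in># Y. n \<le> y#})"
    using m by (intro sum.cong) (auto simp: num_ge_copies)
  then show "wraps m (star (V + copies m Y)) = wraps m (star V) + sum_mset Y"
    unfolding wraps_star[OF N] wraps_star[OF NV] by (simp add: sum.distrib Y[simplified])
qed

section \<open>The bijection behind Glaisher's theorem\<close>
definition glaisher_omsets :: "nat \<Rightarrow> part multiset set" where
  "glaisher_omsets m = {V \<in> omsets. \<forall>n\<ge>1. count V (Num n) < m}"

definition regular_omsets :: "nat \<Rightarrow> part multiset set" where
  "regular_omsets m = {X \<in> omsets. \<forall>n. m dvd n \<longrightarrow> Num n \<notin># X}"

lemma count_copies [simp]:
  "count (copies m Y) (Num n) = m * count Y n" "count (copies m Y) (Over n) = 0"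
proof -
  show "count (copies m Y) (Num n) = m * count Y n"
    unfolding copies_def by (induction Y) auto
  show "count (copies m Y) (Over n) = 0"
    using Over_notin_copies[of n m Y] by (simp only: not_in_iff)
qed

lemma part_multiset_eqI:
  assumes "\<And>n. count X (Num n) = count Y (Num n)" "\<And>n. count X (Over n) = count Y (Over n)"
  shows "X = Y"
proof (rule multiset_eqI)
  fix p show "count X p = count Y p" using assms by (cases p) auto
qed

lemma omsets_count_zero:
  assumes "X \<in> omsets"
  shows "count X (Num 0) = 0" "count X (Over 0) = 0"
  using omsets_pos[OF assms, of "Num 0"] omsets_pos[OF assms, of "Over 0"]
  by (auto simp flip: not_in_iff)

lemma omsets_iff:
  "X \<in> omsets \<longleftrightarrow> count X (Num 0) = 0 \<and> count X (Over 0) = 0 \<and> (\<forall>n. count X (Over n) \<le> 1)"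
proof
  assume "X \<in> omsets"
  then show "count X (Num 0) = 0 \<and> count X (Over 0) = 0 \<and> (\<forall>n. count X (Over n) \<le> 1)"
    using omsets_count_zero by (simp add: omsets_def)
next
  assume *: "count X (Num 0) = 0 \<and> count X (Over 0) = 0 \<and> (\<forall>n. count X (Over n) \<le> 1)"
  have "0 < psize p" if "p \<in># X" for p
    using * that by (cases p) (auto intro!: gr0I simp: count_eq_zero_iff)
  then show "X \<in> omsets"
    using * by (simp add: omsets_def)
qed

text \<open>Division with remainder applied to the multiplicity of each non-over-lined part:
  remainders go to \<open>V\<close>, quotients to \<open>Y\<close>. Over-lined parts remain in
  \<open>V\<close>.\<close>

lemma bij_betw_copies:
  assumes m: "1 \<le> m"
  shows "bij_betw (\<lambda>(V, Y). V + copies m Y) (glaisher_omsets m \<times> {Y. 0 \<notin># Y}) omsets"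
    (is "bij_betw ?f ?D _")
proof (rule bij_betw_imageI)
  show "inj_on ?f ?D"
  proof (rule inj_onI, clarify)
    fix V V' Y Y'
    assume V: "V \<in> glaisher_omsets m" and V': "V' \<in> glaisher_omsets m"
      and Y: "0 \<notin># Y" "0 \<notin># Y'" and eq: "V + copies m Y = V' + copies m Y'"
    have N: "count V (Num n) + m * count Y n = count V' (Num n) + m * count Y' n" for n
      using arg_cong[OF eq, of "\<lambda>Z. count Z (Num n)"] by simp
    have O: "count V (Over n) = count V' (Over n)" for n
      using arg_cong[OF eq, of "\<lambda>Z. count Z (Over n)"] by simp
    have cY: "count Y n = count Y' n" for n
    proof (cases "n = 0")
      case True
      then show ?thesis using Y by (simp add: not_in_iff)
    next
      case False
      then have "count V (Num n) < m" "count V' (Num n) < m"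
        using V V' by (auto simp: glaisher_omsets_def)
      then have "(count V (Num n) + m * count Y n) div m = count Y n"
        "(count V' (Num n) + m * count Y' n) div m = count Y' n"
        by simp_all
      then show ?thesis by (simp add: N)
    qed
    then have "V = V'"
      using N O by (intro part_multiset_eqI) auto
    then show "V = V' \<and> Y = Y'"
      using cY by (auto intro: multiset_eqI)
  qed
  show "?f ` ?D = omsets"
  proof (intro set_eqI iffI)
    fix X assume "X \<in> ?f ` ?D"
    then show "X \<in> omsets"
      by (auto simp: glaisher_omsets_def omsets_iff not_in_iff)
  next
    fix X assume X: "X \<in> omsets"
    define c where "c n = count X (Num n) div m" for n
    have "{n. 0 < c n} \<subseteq> Num -` set_mset X"
      by (auto simp: c_def intro!: count_inI)
    moreover have "finite (Num -` set_mset X)"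
      by (rule finite_vimageI) (auto simp: inj_def)
    ultimately have "finite {n. 0 < c n}"
      by (rule finite_subset)
    then have cnt: "count (Abs_multiset c) = c"
      by simp
    define Y where "Y = Abs_multiset c"
    define V where "V = X - copies m Y"
    have cY: "count Y n = count X (Num n) div m" for n
      by (simp add: Y_def cnt c_def)
    have VN: "count V (Num n) = count X (Num n) mod m" for n
      by (simp add: V_def cY minus_mult_div_eq_mod)
    have VO: "count V (Over n) = count X (Over n)" for n
      by (simp add: V_def)
    have "V + copies m Y = X"
      using VN VO by (intro part_multiset_eqI) (auto simp: cY)
    moreover have "V \<in> glaisher_omsets m"
      using X m by (auto simp: glaisher_omsets_def omsets_iff VN VO)
    moreover have "0 \<notin># Y"
      using omsets_count_zero[OF X] by (simp add: not_in_iff cY)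
    ultimately show "X \<in> ?f ` ?D"
      by (intro image_eqI[of _ _ "(V, Y)"]) auto
  qed
qed

lemma count_Num_mult:
  assumes "1 \<le> m"
  shows "count {#Num (m * y). y \<in># Y#} (Num n) = (if m dvd n then count Y (n div m) else 0)"
    and "count {#Num (m * y). y \<in># Y#} (Over n) = 0"
  using assms by (induction Y) (auto elim!: dvdE intro: dvdI[OF sym])

text \<open>\<open>Y\<close> collects the cofactors of the non-over-lined multiples of
  \<open>m\<close>. Over-lined multiples stay in the regular factor, since their colour is not
  trivial.\<close>

lemma bij_betw_Num_mult:
  assumes m: "1 \<le> m"
  shows "bij_betw (\<lambda>(X, Y). X + {#Num (m * y). y \<in># Y#}) (regular_omsets m \<times> {Y. 0 \<notin># Y}) omsets"
    (is "bij_betw ?f ?D _")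
proof (rule bij_betw_imageI)
  note cnt = count_Num_mult[OF m]
  show "inj_on ?f ?D"
  proof (rule inj_onI, clarify)
    fix X X' Y Y'
    assume X: "X \<in> regular_omsets m" "X' \<in> regular_omsets m"
      and eq: "X + {#Num (m * y). y \<in># Y#} = X' + {#Num (m * y). y \<in># Y'#}"
    have N: "count X (Num n) + (if m dvd n then count Y (n div m) else 0)
        = count X' (Num n) + (if m dvd n then count Y' (n div m) else 0)" for n
      using arg_cong[OF eq, of "\<lambda>Z. count Z (Num n)"] by (simp add: cnt)
    have O: "count X (Over n) = count X' (Over n)" for n
      using arg_cong[OF eq, of "\<lambda>Z. count Z (Over n)"] by (simp add: cnt)
    have X0: "count X (Num n) = 0" "count X' (Num n) = 0" if "m dvd n" for n
      using X that by (auto simp: regular_omsets_def not_in_iff)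
    have "count Y n = count Y' n" for n
      using N[of "m * n"] X0[of "m * n"] m by simp
    moreover have "X = X'"
    proof (rule part_multiset_eqI)
      fix n show "count X (Num n) = count X' (Num n)"
        using N[of n] X0[of n] by (cases "m dvd n") auto
    qed (rule O)
    ultimately show "X = X' \<and> Y = Y'"
      by (auto intro: multiset_eqI)
  qed
  show "?f ` ?D = omsets"
  proof (intro set_eqI iffI)
    fix X assume "X \<in> ?f ` ?D"
    then show "X \<in> omsets"
      by (auto simp: regular_omsets_def omsets_iff not_in_iff cnt)
  next
    fix Z assume Z: "Z \<in> omsets"
    define Q where "Q p \<longleftrightarrow> (\<exists>n. p = Num (m * n))" for p
    define X where "X = {#p \<in># Z. \<not> Q p#}"
    define Y where "Y = {#psize p div m. p \<in># {#p \<in># Z. Q p#}#}"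
    have "{#Num (m * y). y \<in># Y#} = {#p. p \<in># {#p \<in># Z. Q p#}#}"
      unfolding Y_def image_mset.compositionality comp_def
      using m by (intro image_mset_cong) (auto simp: Q_def)
    then have "X + {#Num (m * y). y \<in># Y#} = Z"
      by (simp add: X_def add.commute flip: multiset_partition)
    moreover have "X \<in> regular_omsets m"
      using Z by (auto simp: regular_omsets_def omsets_def X_def Q_def elim: dvdE)
    moreover have "0 \<notin># Y"
      using omsets_pos[OF Z, of "Num 0"] m by (auto simp: Y_def Q_def)
    ultimately show "Z \<in> ?f ` ?D"
      by (intro image_eqI[of _ _ "(X, Y)"]) auto
  qed
qed

lemma letters_wraps_Num_mult:
  assumes "1 \<le> m"
  shows "letters m (X + {#Num (m * y). y \<in># Y#}) = letters m X"
    and "wraps m (X + {#Num (m * y). y \<in># Y#}) = wraps m X + sum_mset Y"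
  using assms by (induction Y) (auto simp: letters_def wraps_def letter_def)

section \<open>Finite fibres and cancellation\<close>

lemma finite_multisets_weight:
  fixes h :: "'b \<Rightarrow> nat"
  assumes "finite {x. h x \<le> n}"
  shows "finite {X. (\<forall>x\<in>#X. 0 < h x) \<and> (\<Sum>x\<in>#X. h x) = n}"
proof (rule finite_subset[OF _ finite_multisets_bounded[OF assms, of n]])
  have "size X \<le> (\<Sum>x\<in>#X. h x)" if "\<forall>x\<in>#X. 0 < h x" for X
    using that by (induction X) (auto simp: Suc_le_eq less_Suc_eq_le intro: add_less_le_mono)
  moreover have "h x \<le> (\<Sum>x\<in>#X. h x)" if "x \<in># X" for x X
    using that by (metis image_mset_add_mset le_add1 multi_member_split sum_mset.insert)
  ultimately show "{X. (\<forall>x\<in>#X. 0 < h x) \<and> (\<Sum>x\<in>#X. h x) = n} \<subseteq> {X. set_mset X \<subseteq> {x. h x \<le> n} \<and> size X \<le> n}"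
    by auto
qed

text \<open>Summing \<open>psize p = psize p mod m + m * (psize p div m)\<close> over
  \<open>X\<close> shows that the two statistics fix the total size, and only finitely many
  multisets of positive parts have a given total.\<close>

lemma finite_stat_fibre: "finite {X \<in> omsets. letters m X = L \<and> wraps m X = k}"
proof (rule finite_subset)
  define n where "n = (\<Sum>q\<in>#L. psize q) + m * k"
  have total: "(\<Sum>p\<in>#X. psize p) = (\<Sum>q\<in>#letters m X. psize q) + m * wraps m X" for X
    by (induction X) (auto simp: letters_def wraps_def letter_def algebra_simps split: if_splits)
  show "{X \<in> omsets. letters m X = L \<and> wraps m X = k}
      \<subseteq> {X. (\<forall>x\<in>#X. 0 < psize x) \<and> (\<Sum>x\<in>#X. psize x) = n}"
  proof
    fix X assume "X \<in> {X \<in> omsets. letters m X = L \<and> wraps m X = k}"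
    then show "X \<in> {X. (\<forall>x\<in>#X. 0 < psize x) \<and> (\<Sum>x\<in>#X. psize x) = n}"
      using total[of X] by (simp add: n_def omsets_def)
  qed
  have "{p. psize p \<le> n} \<subseteq> Num ` {..n} \<union> Over ` {..n}"
  proof
    fix p assume "p \<in> {p. psize p \<le> n}"
    then show "p \<in> Num ` {..n} \<union> Over ` {..n}" by (cases p) auto
  qed
  then have "finite {p. psize p \<le> n}"
    by (rule finite_subset) auto
  then show "finite {X. (\<forall>x\<in>#X. 0 < psize x) \<and> (\<Sum>x\<in>#X. psize x) = n}"
    by (rule finite_multisets_weight)
qed

text \<open>The coefficient formula for a Cauchy product, stated with cardinalities: the bijection
  cuts each fibre into disjoint rectangles, one for every way to share the degree
  \<open>n\<close>.\<close>

lemma card_fibre_product: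
  fixes kP :: "'a \<Rightarrow> nat" and z :: "'c \<Rightarrow> nat"
  assumes a: "bij_betw a (P \<times> M) A"
    and st: "\<And>p y. p \<in> P \<Longrightarrow> y \<in> M \<Longrightarrow> w (a (p, y)) = wP p \<and> k (a (p, y)) = kP p + z y"
    and finP: "\<And>v n. finite {p \<in> P. wP p = v \<and> kP p = n}"
    and finM: "\<And>n. finite {y \<in> M. z y = n}"
  shows "card {x \<in> A. w x = v \<and> k x = n} =
    (\<Sum>i\<le>n. card {p \<in> P. wP p = v \<and> kP p = i} * card {y \<in> M. z y = n - i})"
proof -
  let ?T = "\<lambda>i. {p \<in> P. wP p = v \<and> kP p = i} \<times> {y \<in> M. z y = n - i}"
  have "{x \<in> A. w x = v \<and> k x = n} = a ` (\<Union>i\<le>n. ?T i)"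
    (is "?L = ?R")
  proof
    show "?L \<subseteq> ?R"
    proof
      fix x assume x: "x \<in> ?L"
      then obtain p y where py: "p \<in> P" "y \<in> M" "x = a (p, y)"
        using a by (auto simp: bij_betw_def)
      then have "wP p = v" "kP p + z y = n"
        using st[OF py(1,2)] x by auto
      then show "x \<in> ?R"
        using py by (intro image_eqI[of _ _ "(p, y)"]) auto
    qed
    show "?R \<subseteq> ?L"
      using st bij_betwE[OF a] by auto
  qed
  moreover have "inj_on a (\<Union>i\<le>n. ?T i)"
    using a by (auto simp: bij_betw_def intro: inj_on_subset)
  ultimately have "card ?L = card (\<Union>i\<le>n. ?T i)"
    by (simp add: card_image)
  also have "\<dots> = (\<Sum>i\<le>n. card (?T i))"
    using finP finM by (intro card_UN_disjoint) auto
  finally show ?thesis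
    by (simp add: card_cartesian_product)
qed

text \<open>The factor \<open>M\<close> can be cancelled by induction on the degree because it has a single element of
  degree 0.\<close>

lemma cancel_common_factor:
  fixes kP :: "'a \<Rightarrow> nat" and kG :: "'b \<Rightarrow> nat" and z :: "'c \<Rightarrow> nat"
  assumes a: "bij_betw a (P \<times> M) A" and b: "bij_betw b (G \<times> M) A"
    and sta: "\<And>p y. p \<in> P \<Longrightarrow> y \<in> M \<Longrightarrow> w (a (p, y)) = wP p \<and> k (a (p, y)) = kP p + z y"
    and stb: "\<And>p y. p \<in> G \<Longrightarrow> y \<in> M \<Longrightarrow> w (b (p, y)) = wG p \<and> k (b (p, y)) = kG p + z y"
    and finP: "\<And>v n. finite {p \<in> P. wP p = v \<and> kP p = n}"
    and finG: "\<And>v n. finite {p \<in> G. wG p = v \<and> kG p = n}"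
    and finM: "\<And>n. finite {y \<in> M. z y = n}"
    and M0: "card {y \<in> M. z y = 0} = 1"
  obtains f where "bij_betw f P G" "\<And>p. p \<in> P \<Longrightarrow> wG (f p) = wP p \<and> kG (f p) = kP p"
proof -
  define Pf where "Pf v n = {p \<in> P. wP p = v \<and> kP p = n}" for v n
  define Gf where "Gf v n = {p \<in> G. wG p = v \<and> kG p = n}" for v n
  define Mf where "Mf n = {y \<in> M. z y = n}" for n
  have sums: "(\<Sum>i\<le>n. card (Pf v i) * card (Mf (n - i))) = (\<Sum>i\<le>n. card (Gf v i) * card (Mf (n - i)))"
    for v n
    unfolding Pf_def Gf_def Mf_def
    using card_fibre_product[OF a sta finP finM, of v n] card_fibre_product[OF b stb finG finM, of v n]
    by simp
  have card_eq: "card (Pf v n) = card (Gf v n)" for v n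
  proof (induction n rule: less_induct)
    case (less n)
    have "(\<Sum>i<n. card (Pf v i) * card (Mf (n - i))) = (\<Sum>i<n. card (Gf v i) * card (Mf (n - i)))"
      using less by (intro sum.cong) auto
    then show ?case
      using sums[of v n] M0 by (simp add: Mf_def lessThan_Suc_atMost[symmetric])
  qed
  have "\<exists>g. bij_betw g (Pf v n) (Gf v n)" for v n
    by (rule finite_same_card_bij) (use finP finG card_eq in \<open>auto simp: Pf_def Gf_def\<close>)
  then obtain g where g: "\<And>v n. bij_betw (g v n) (Pf v n) (Gf v n)"
    by metis
  \<comment> \<open>The fibrewise bijections glue to a single one because every element lies in
    exactly one fibre.\<close>
  define f where "f p = g (wP p) (kP p) p" for p
  have f: "f p \<in> G \<and> wG (f p) = wP p \<and> kG (f p) = kP p" if "p \<in> P" for p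
    using bij_betwE[OF g, of "wP p" "kP p"] that by (auto simp: f_def Pf_def Gf_def)
  have "bij_betw f P G"
  proof (rule bij_betw_imageI)
    show "inj_on f P"
    proof (rule inj_onI)
      fix p q assume pq: "p \<in> P" "q \<in> P" "f p = f q"
      then have "wP p = wP q" "kP p = kP q"
        using f by metis+
      then show "p = q"
        using pq g[of "wP p" "kP p"] by (auto simp: f_def Pf_def bij_betw_def inj_on_def)
    qed
    show "f ` P = G"
    proof
      show "f ` P \<subseteq> G" using f by auto
      show "G \<subseteq> f ` P"
      proof
        fix x assume x: "x \<in> G"
        then have "x \<in> g (wG x) (kG x) ` Pf (wG x) (kG x)"
          using g[of "wG x" "kG x"] by (simp add: bij_betw_def Gf_def)
        then obtain p where "p \<in> Pf (wG x) (kG x)" "x = g (wG x) (kG x) p" by blast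
        then show "x \<in> f ` P"
          by (intro image_eqI[of _ _ p]) (auto simp: f_def Pf_def)
      qed
    qed
  qed
  then show thesis
    using f that by blast
qed

lemma ex_stat_preserving_bij:
  assumes m: "1 \<le> m"
  obtains f where "bij_betw f (glaisher_omsets m) (regular_omsets m)"
    "\<And>V. V \<in> glaisher_omsets m \<Longrightarrow>
       letters m (f V) = letters m (star V) \<and> wraps m (f V) = wraps m (star V)"
proof (rule cancel_common_factor)
  \<comment> \<open>Applying \<open>star\<close> after the insertion makes both parametrizations end
    in \<open>omsets\<close>, where the same two statistics are read off. The common factor is
    graded by \<open>sum_mset\<close>.\<close>
  show "bij_betw ((\<lambda>X. star X) \<circ> (\<lambda>(V, Y). V + copies m Y)) (glaisher_omsets m \<times> {Y. 0 \<notin># Y}) omsets"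
    by (rule bij_betw_trans[OF bij_betw_copies[OF m] bij_betw_star])
  show "bij_betw (\<lambda>(X, Y). X + {#Num (m * y). y \<in># Y#}) (regular_omsets m \<times> {Y. 0 \<notin># Y}) omsets"
    by (rule bij_betw_Num_mult[OF m])
  show "letters m (((\<lambda>X. star X) \<circ> (\<lambda>(V, Y). V + copies m Y)) (V, Y)) = letters m (star V) \<and>
    wraps m (((\<lambda>X. star X) \<circ> (\<lambda>(V, Y). V + copies m Y)) (V, Y)) = wraps m (star V) + sum_mset Y"
    for V Y
    using stat_star_copies[OF m] by simp
  show "letters m ((\<lambda>(X, Y). X + {#Num (m * y). y \<in># Y#}) (X, Y)) = letters m X \<and>
    wraps m ((\<lambda>(X, Y). X + {#Num (m * y). y \<in># Y#}) (X, Y)) = wraps m X + sum_mset Y" for X Y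
    using letters_wraps_Num_mult[OF m] by simp
  show "finite {V \<in> glaisher_omsets m. letters m (star V) = L \<and> wraps m (star V) = k}" for L k
  proof (rule inj_on_finite)
    show "inj_on (\<lambda>X. star X) {V \<in> glaisher_omsets m. letters m (star V) = L \<and> wraps m (star V) = k}"
      by (rule inj_on_subset[OF bij_betw_imp_inj_on[OF bij_betw_star]]) (auto simp: glaisher_omsets_def)
    show "(\<lambda>X. star X) ` {V \<in> glaisher_omsets m. letters m (star V) = L \<and> wraps m (star V) = k}
        \<subseteq> {X \<in> omsets. letters m X = L \<and> wraps m X = k}"
      using star_in_omsets by (auto simp: glaisher_omsets_def)
  qed (rule finite_stat_fibre)
  show "finite {X \<in> regular_omsets m. letters m X = L \<and> wraps m X = k}" for L k
    by (rule finite_subset[OF _ finite_stat_fibre[of m L k]]) (auto simp: regular_omsets_def)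
  show "finite {Y \<in> {Y. 0 \<notin># Y}. sum_mset Y = n}" for n :: nat
  proof (rule finite_subset)
    show "{Y \<in> {Y. 0 \<notin># Y}. sum_mset Y = n} \<subseteq> {Y. (\<forall>y\<in>#Y. 0 < id y) \<and> (\<Sum>y\<in>#Y. id y) = n}"
      by (auto simp: id_def intro: gr0I)
    show "finite {Y. (\<forall>y\<in>#Y. 0 < id y) \<and> (\<Sum>y\<in>#Y. id y) = n}"
      by (rule finite_multisets_weight) simp
  qed
  have "{Y \<in> {Y. 0 \<notin># Y}. sum_mset Y = 0} = {{#} :: nat multiset}"
    by (auto simp: sum_mset_0_iff) (metis multiset_nonemptyE)
  then show "card {Y \<in> {Y. 0 \<notin># Y}. sum_mset Y = (0 :: nat)} = 1"
    by simp
qed (use that in blast)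

section \<open>Monomials of over-partitions\<close>
lemma nmul_0 [simp]: "nmul 0 a = 0"
  by (simp add: nmul_def)

lemma nmul_Suc [simp]: "nmul (Suc k) a = nmul k a + a"
  by (simp add: nmul_def)

lemma nmul_add: "nmul (k + l) a = nmul k a + nmul l a"
  by (induction l) (simp_all add: ac_simps)

lemma psum_0 [simp]: "psum s 0 = 0"
  by (simp add: psum_def)

lemma psum_Suc [simp]: "psum s (Suc n) = psum s n + s (Suc n)"
  by (simp add: psum_def)

lemma psum_add_period:
  assumes "\<forall>i\<ge>1. s (i + m) = s i"
  shows "psum s (n + q * m) = psum s n + nmul q (psum s m)"
proof -
  have 1: "psum s (n + m) = psum s n + psum s m" for n
  proof (induction n)
    case (Suc n)
    have "s (Suc (n + m)) = s (Suc n)"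
      using assms[rule_format, of "Suc n"] by simp
    with Suc show ?case by (simp add: ac_simps)
  qed simp
  show ?thesis
  proof (induction q)
    case (Suc q)
    then show ?case using 1[of "n + q * m"] by (simp add: ac_simps)
  qed simp
qed

text \<open>A part \<open>x\<close> of the conjugate adds one to each of the first \<open>x\<close>
  entries of the over-partition, hence the exponent \<open>psum s x\<close>. The colour index is the
  representative of \<open>x\<close> in \<open>{1..m}\<close>; a non-over-lined multiple of
  \<open>m\<close> gets no colour as \<open>c_m = 1\<close>.\<close>

definition part_mon :: "nat \<Rightarrow> (nat \<Rightarrow> 'a::comm_monoid_add) \<Rightarrow> part \<Rightarrow> 'a mon" where
  "part_mon m s p = (case p of
     Num x \<Rightarrow> (if m dvd x then 0 else Poly_Mapping.single (C (x mod m)) 1, psum s x)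
   | Over x \<Rightarrow> (Poly_Mapping.single (Cbar (if m dvd x then m else x mod m)) 1, psum s x))"

definition mset_mon :: "nat \<Rightarrow> (nat \<Rightarrow> 'a::comm_monoid_add) \<Rightarrow> part multiset \<Rightarrow> 'a mon" where
  "mset_mon m s X = (\<Sum>p\<in>#X. part_mon m s p)"

lemma mset_mon_empty [simp]: "mset_mon m s {#} = 0"
  and mset_mon_add_mset [simp]: "mset_mon m s (add_mset p X) = part_mon m s p + mset_mon m s X"
  and mset_mon_plus [simp]: "mset_mon m s (X + Y) = mset_mon m s X + mset_mon m s Y"
  by (simp_all add: mset_mon_def)

lemma part_mon_letter:
  assumes "\<forall>i\<ge>1. s (i + m) = s i"
  shows "part_mon m s p = part_mon m s (letter m p) + (0, nmul (psize p div m) (psum s m))"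
proof -
  have "psum s (psize p) = psum s (psize p mod m) + nmul (psize p div m) (psum s m)"
    using psum_add_period[OF assms, of "psize p mod m" "psize p div m"] by simp
  then show ?thesis
    by (cases p) (simp_all add: part_mon_def letter_def dvd_mod_iff)
qed

text \<open>This turns a bijection that preserves \<open>letters\<close> and \<open>wraps\<close>
  into one that preserves monomials. It works because \<open>Num 0\<close> has the trivial monomial
  and \<open>Over 0\<close> the colour \<open>Cbar m\<close>.\<close>

lemma mset_mon_stat:
  assumes "\<forall>i\<ge>1. s (i + m) = s i"
  shows "mset_mon m s X = mset_mon m s (letters m X) + (0, nmul (wraps m X) (psum s m))"
proof (induction X)
  case (add p X)
  have "mset_mon m s (letters m (add_mset p X)) = part_mon m s (letter m p) + mset_mon m s (letters m X)"
    by (auto simp: letters_def part_mon_def simp flip: zero_prod_def)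
  moreover have "wraps m (add_mset p X) = psize p div m + wraps m X"
    by (simp add: wraps_def)
  ultimately show ?case
    using add part_mon_letter[OF assms, of p] by (simp add: nmul_add ac_simps)
qed (simp add: letters_def wraps_def zero_prod_def)

text \<open>Exchange of summations: a part \<open>p\<close> is counted by \<open>num_ge X i\<close>
  exactly for \<open>i \<le> psize p\<close>, so it collects the first \<open>psize p\<close> values
  of \<open>s\<close>.\<close>

lemma sum_nmul_num_ge:
  assumes "\<forall>p\<in>#X. psize p \<le> N"
  shows "(\<Sum>i=1..N. nmul (num_ge X i) (s i)) = (\<Sum>p\<in>#X. psum s (psize p))"
  using assms
proof (induction X)
  case empty
  then show ?case by (simp add: num_ge_def)
next
  case (add p X)
  have "(\<Sum>i=1..N. nmul (num_ge (add_mset p X) i) (s i))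
      = (\<Sum>i=1..N. if i \<le> psize p then s i else 0) + (\<Sum>i=1..N. nmul (num_ge X i) (s i))"
    unfolding sum.distrib[symmetric] by (rule sum.cong) (auto simp: num_ge_def ac_simps)
  also have "(\<Sum>i=1..N. if i \<le> psize p then s i else 0) = psum s (psize p)"
    unfolding psum_def using add.prems by (intro sum.mono_neutral_cong_right) auto
  finally show ?case using add by simp
qed

lemma weight_conjugate: "weight s (conjugate X) = (\<Sum>p\<in>#X. psum s (psize p))"
proof -
  obtain N where N: "\<forall>p\<in>#X. psize p \<le> N"
    using finite_nat_set_iff_bounded_le[of "psize ` set_mset X"] by auto
  have "{i. 1 \<le> i \<and> conjugate X i \<noteq> Num 0} \<subseteq> {1..N}"
  proof
    fix i assume "i \<in> {i. 1 \<le> i \<and> conjugate X i \<noteq> Num 0}"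
    then have "1 \<le> i" "num_ge X i \<noteq> 0"
      by (auto simp: conjugate_eq_Num0)
    then show "i \<in> {1..N}"
      using N num_ge_eq_0_iff[of X i] by (auto simp: not_less intro: order_trans)
  qed
  then have "weight s (conjugate X) = (\<Sum>i=1..N. nmul (num_ge X i) (s i))"
    unfolding weight_def by (intro sum.mono_neutral_cong_left) (auto simp: conjugate_eq_Num0)
  then show ?thesis
    using sum_nmul_num_ge[OF N] by simp
qed

section \<open>Colour exponents as numbers of parts of the conjugate\<close>

lemma Sum_any_count:
  assumes "inj f"
  shows "Sum_any (\<lambda>i. int (count X (f i))) = int (size {#p \<in># X. p \<in> range f#})"
proof (induction X)
  case (add p X)
  have "finite (f -` set_mset X)"
    using assms by (intro finite_vimageI) auto
  then have fin: "finite {i. int (count X (f i)) \<noteq> 0}"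
    by (rule finite_subset[rotated]) auto
  have fin1: "finite {i. int (of_bool (f i = p)) \<noteq> 0}"
    by (rule finite_subset[OF _ finite_vimageI[of "{p}", OF _ assms]]) auto
  have "Sum_any (\<lambda>i. int (count (add_mset p X) (f i)))
      = Sum_any (\<lambda>i. int (of_bool (f i = p)) + int (count X (f i)))"
    by (intro Sum_any.cong) auto
  also have "\<dots> = Sum_any (\<lambda>i. int (of_bool (f i = p))) + Sum_any (\<lambda>i. int (count X (f i)))"
    using fin1 fin by (rule Sum_any.distrib)
  also have "Sum_any (\<lambda>i. int (of_bool (f i = p))) = of_bool (p \<in> range f)"
  proof (cases "p \<in> range f")
    case True
    then obtain j where "p = f j" by blast
    then have "(\<lambda>i. int (of_bool (f i = p))) = (\<lambda>i. if i = j then 1 else 0)"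
      using assms by (auto simp: inj_eq fun_eq_iff)
    then have "Sum_any (\<lambda>i. int (of_bool (f i = p))) = Sum_any (\<lambda>i. if i = j then 1 else 0)"
      by (simp only:)
    then show ?thesis using True by simp
  next
    case False
    then have "f i \<noteq> p" for i
      by auto
    then show ?thesis using False by simp
  qed
  finally show ?case using add by simp
qed simp

lemma inj_progression:
  assumes "1 \<le> m"
  shows "inj (\<lambda>i. Num (j + i * m))" "inj (\<lambda>i. Over (j + i * m))"
  using assms by (auto simp: inj_def)

lemma rho_conjugate:
  assumes "X \<in> omsets" "1 \<le> j" "1 \<le> m"
  shows "rho m j (conjugate X) = int (size {#p \<in># X. p \<in> range (\<lambda>i. Num (j + i * m))#})"
proof -
  have "int (psize (conjugate X (j + i * m))) - int (psize (conjugate X (j + 1 + i * m)))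
      - of_bool (is_over (conjugate X (j + i * m))) = int (count X (Num (j + i * m)))" for i
    using num_ge_Suc_omset[OF assms(1), of "j + i * m"] assms(2) by simp
  then show ?thesis
    unfolding rho_def Sum_any_count[OF inj_progression(1)[OF assms(3)], symmetric] by simp
qed

lemma rhobar_conjugate:
  assumes "X \<in> omsets" "1 \<le> j" "1 \<le> m"
  shows "rhobar m j (conjugate X) = size {#p \<in># X. p \<in> range (\<lambda>i. Over (j + i * m))#}"
proof -
  let ?f = "\<lambda>i. Over (j + i * m)"
  have "rhobar m j (conjugate X) = card {i. ?f i \<in># X}"
    unfolding rhobar_def using assms(2) by (simp add: trans_le_add1)
  also have "\<dots> = card (?f ` {i. ?f i \<in># X})"
    using inj_progression(2)[OF assms(3)] by (intro card_image[symmetric]) (auto intro: inj_on_subset)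
  also have "?f ` {i. ?f i \<in># X} = set_mset {#p \<in># X. p \<in> range ?f#}"
    by auto
  \<comment> \<open>Over-lined parts have multiplicity one, so counting the set and counting the
    multiset agree.\<close>
  also have "card (set_mset {#p \<in># X. p \<in> range ?f#}) = size {#p \<in># X. p \<in> range ?f#}"
    unfolding size_multiset_overloaded_eq card_eq_sum
    using omsets_count_Over[OF assms(1)] by (intro sum.cong) auto
  finally show ?thesis .
qed

text \<open>Residue classes are represented by \<open>1, ..., m\<close> rather than
  \<open>0, ..., m - 1\<close>. The value \<open>x = 0\<close> has to be excluded: it is a multiple
  of \<open>m\<close> but not of the form \<open>m + i * m\<close>.\<close>

lemma ex_residue_iff:
  fixes j m x :: nat
  assumes "1 \<le> j" "j \<le> m" "0 < x"
  shows "(\<exists>i. x = j + i * m) \<longleftrightarrow> j = (if m dvd x then m else x mod m)"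
proof
  assume "\<exists>i. x = j + i * m"
  then obtain i where i: "x = j + i * m" by blast
  show "j = (if m dvd x then m else x mod m)"
  proof (cases "j = m")
    case False
    then have "\<not> m dvd j" using assms by (auto dest: dvd_imp_le)
    then have "\<not> m dvd x" using i by (simp add: dvd_add_left_iff)
    then show ?thesis using i assms False by simp
  qed (simp add: i)
next
  assume *: "j = (if m dvd x then m else x mod m)"
  show "\<exists>i. x = j + i * m"
  proof (cases "m dvd x")
    case True
    then obtain k where k: "x = m * k" by blast
    then obtain k' where "k = Suc k'" using assms by (cases k) auto
    then show ?thesis using k * True by (intro exI[of _ k']) simp
  next
    case False
    then show ?thesis using * by (intro exI[of _ "x div m"]) simp
  qed
qed

text \<open>Each part lies in exactly one of the progressions that start in \<open>{1..m}\<close>.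
  The first sum stops before \<open>m\<close>, matching the missing indeterminate
  \<open>c_m\<close>.\<close>

lemma fst_mset_mon:
  assumes m: "1 \<le> m" and pos: "\<forall>p\<in>#X. 0 < psize p"
  shows "fst (mset_mon m s X) =
    (\<Sum>j=1..<m. Poly_Mapping.single (C j) (size {#p \<in># X. p \<in> range (\<lambda>i. Num (j + i * m))#})) +
    (\<Sum>j=1..m. Poly_Mapping.single (Cbar j) (size {#p \<in># X. p \<in> range (\<lambda>i. Over (j + i * m))#}))"
  using pos
proof (induction X)
  case (add p X)
  let ?N = "\<lambda>j p. p \<in> range (\<lambda>i. Num (j + i * m))" and ?O = "\<lambda>j p. p \<in> range (\<lambda>i. Over (j + i * m))"
  have *: "size {#q \<in># add_mset p X. Q q#} = of_bool (Q p) + size {#q \<in># X. Q q#}" for Q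
    by simp
  have "fst (part_mon m s p) = (\<Sum>j=1..<m. Poly_Mapping.single (C j) (of_bool (?N j p)))
      + (\<Sum>j=1..m. Poly_Mapping.single (Cbar j) (of_bool (?O j p)))"
  proof (cases p)
    case (Num x)
    have x: "0 < x" using add.prems Num by simp
    have "(\<Sum>j=1..<m. Poly_Mapping.single (C j) (of_bool (?N j p)))
        = (\<Sum>j=1..<m. if (if m dvd x then m else x mod m) = j then Poly_Mapping.single (C j) (1::nat) else 0)"
    proof (rule sum.cong)
      fix j assume "j \<in> {1..<m}"
      then have "?N j p \<longleftrightarrow> j = (if m dvd x then m else x mod m)"
        using ex_residue_iff[of j m x] x Num by (auto simp: image_iff)
      then show "Poly_Mapping.single (C j) (of_bool (?N j p)) =
          (if (if m dvd x then m else x mod m) = j then Poly_Mapping.single (C j) (1::nat) else 0)"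
        by auto
    qed simp
    also have "\<dots> = fst (part_mon m s p)"
      using m Num mod_less_divisor[of m x] by (auto simp: part_mon_def sum.delta' mod_eq_0_iff_dvd Suc_le_eq intro: gr0I)
    finally show ?thesis using Num by (simp add: image_iff)
  next
    case (Over x)
    have x: "0 < x" using add.prems Over by simp
    have "(\<Sum>j=1..m. Poly_Mapping.single (Cbar j) (of_bool (?O j p)))
        = (\<Sum>j=1..m. if (if m dvd x then m else x mod m) = j then Poly_Mapping.single (Cbar j) (1::nat) else 0)"
    proof (rule sum.cong)
      fix j assume "j \<in> {1..m}"
      then have "?O j p \<longleftrightarrow> j = (if m dvd x then m else x mod m)"
        using ex_residue_iff[of j m x] x Over by (auto simp: image_iff)
      then show "Poly_Mapping.single (Cbar j) (of_bool (?O j p)) =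
          (if (if m dvd x then m else x mod m) = j then Poly_Mapping.single (Cbar j) (1::nat) else 0)"
        by auto
    qed simp
    also have "\<dots> = fst (part_mon m s p)"
      using m Over mod_less_divisor[of m x] by (auto simp: part_mon_def sum.delta' mod_eq_0_iff_dvd Suc_le_eq intro: gr0I)
    finally show ?thesis using Over by (simp add: image_iff)
  qed
  then show ?case
    using add by (simp only: * mset_mon_add_mset fst_add single_add sum.distrib) (simp add: ac_simps)
qed simp

lemma snd_mset_mon: "snd (mset_mon m s X) = (\<Sum>p\<in>#X. psum s (psize p))"
proof (induction X)
  case (add p X)
  then show ?case by (cases p) (simp_all add: part_mon_def)
qed simp

lemma single_power: "(Poly_Mapping.single t 1 :: 'a::comm_monoid_add \<Rightarrow>\<^sub>0 int) ^ n = Poly_Mapping.single (nmul n t) 1"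
  by (induction n) (simp_all add: mult_single ac_simps)

lemma single_prod:
  "(\<Prod>j\<in>A. Poly_Mapping.single (t j) 1 :: 'a::comm_monoid_add \<Rightarrow>\<^sub>0 int) = Poly_Mapping.single (\<Sum>j\<in>A. t j) 1"
  by (induction A rule: infinite_finite_induct) (simp_all add: mult_single)

lemma nmul_Pair: "nmul n (a, b) = (nmul n a, nmul n b)"
  by (induction n) (simp_all add: zero_prod_def)

lemma nmul_zero [simp]: "nmul n 0 = 0"
  by (induction n) simp_all

lemma nmul_single: "nmul n (Poly_Mapping.single c (1::nat)) = Poly_Mapping.single c n"
  by (induction n) (simp_all add: single_add[symmetric])

lemma col_power: "col j ^ n = Poly_Mapping.single (Poly_Mapping.single (C j) n, 0) 1"
  and colbar_power: "colbar j ^ n = Poly_Mapping.single (Poly_Mapping.single (Cbar j) n, 0) 1"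
  by (simp_all only: col_def colbar_def single_power nmul_Pair nmul_single nmul_zero)

lemma sum_Pair: "(\<Sum>j\<in>A. (f j, g j)) = (sum f A, sum g A)"
  by (induction A rule: infinite_finite_induct) (simp_all add: zero_prod_def)

lemma term_Pbar_conjugate:
  assumes X: "X \<in> omsets" and m: "1 \<le> m"
  shows "term_Pbar m s (conjugate X) = Poly_Mapping.single (mset_mon m s X) 1"
proof -
  define a where "a j = size {#p \<in># X. p \<in> range (\<lambda>i. Num (j + i * m))#}" for j
  define b where "b j = size {#p \<in># X. p \<in> range (\<lambda>i. Over (j + i * m))#}" for j
  have "term_Pbar m s (conjugate X) =
      (\<Prod>j=1..<m. col j ^ a j * colbar j ^ b j) * colbar m ^ b m * qpow (weight s (conjugate X))"
    unfolding term_Pbar_def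
    using rho_conjugate[OF X _ m] rhobar_conjugate[OF X _ m] m by (simp add: a_def b_def)
  also have "\<dots> = Poly_Mapping.single ((\<Sum>j=1..<m. Poly_Mapping.single (C j) (a j) + Poly_Mapping.single (Cbar j) (b j))
      + Poly_Mapping.single (Cbar m) (b m), weight s (conjugate X)) 1"
    by (simp add: col_power colbar_power qpow_def mult_single single_prod sum_Pair)
  also have "(\<Sum>j=1..<m. Poly_Mapping.single (C j) (a j) + Poly_Mapping.single (Cbar j) (b j))
      + Poly_Mapping.single (Cbar m) (b m) = fst (mset_mon m s X)"
  proof -
    have "{1..m} = insert m {1..<m}" using m by auto
    then show ?thesis
      using X by (simp add: fst_mset_mon[OF m] omsets_def a_def b_def sum.distrib ac_simps)
  qed
  also have "weight s (conjugate X) = snd (mset_mon m s X)"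
    by (simp add: weight_conjugate snd_mset_mon)
  finally show ?thesis by simp
qed

section \<open>Products of formal series\<close>
text \<open>The image under \<open>h\<close> of the formal sum of the elements \<open>x\<close> with
  coefficients \<open>w x\<close>. It is meaningful when the fibres are finite, since a sum over an
  infinite set is 0 by default.\<close>

definition push :: "('b \<Rightarrow> 'a::comm_monoid_add mon) \<Rightarrow> ('b \<Rightarrow> int) \<Rightarrow> 'a fseries" where
  "push h w = (\<lambda>t. \<Sum>x | w x \<noteq> 0 \<and> h x = t. w x)"

lemma push_nonzeroD:
  assumes "push h w t \<noteq> 0"
  shows "\<exists>x. w x \<noteq> 0 \<and> h x = t"
proof (rule ccontr)
  assume "\<not> (\<exists>x. w x \<noteq> 0 \<and> h x = t)"
  then have "{x. w x \<noteq> 0 \<and> h x = t} = {}" by blast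
  then have "push h w t = sum w {}"
    unfolding push_def by (rule arg_cong)
  then show False using assms by simp
qed

lemma prod_list_push:
  assumes "length ws = length us"
  shows "prod_list (map2 (\<lambda>X u. X u) (map (push h) ws) us) =
    (\<Sum>xs | list_all2 (\<lambda>w x. w x \<noteq> 0) ws xs \<and> map h xs = us. prod_list (map2 (\<lambda>w x. w x) ws xs))"
  using assms
proof (induction ws us rule: list_induct2)
  case Nil
  have "{xs. xs = [] \<and> map h xs = []} = {[]}" by auto
  then show ?case by simp
next
  case (Cons w ws u us)
  let ?P = "\<lambda>ws xs. prod_list (map2 (\<lambda>w x. w x) ws xs)"
  let ?A = "{x. w x \<noteq> 0 \<and> h x = u}" and ?B = "{xs. list_all2 (\<lambda>w x. w x \<noteq> 0) ws xs \<and> map h xs = us}"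
  have "prod_list (map2 (\<lambda>X u. X u) (map (push h) (w # ws)) (u # us)) = (\<Sum>x\<in>?A. w x) * (\<Sum>xs\<in>?B. ?P ws xs)"
  proof -
    have "push h w u = sum w ?A" by (simp add: push_def)
    then show ?thesis using Cons.IH by simp
  qed
  also have "\<dots> = (\<Sum>(x, xs)\<in>?A \<times> ?B. w x * ?P ws xs)"
    by (simp add: sum_product sum.cartesian_product)
  also have "\<dots> = (\<Sum>xs | list_all2 (\<lambda>w x. w x \<noteq> 0) (w # ws) xs \<and> map h xs = u # us. ?P (w # ws) xs)"
    by (rule sum.reindex_bij_witness[where i = "\<lambda>xs. (hd xs, tl xs)" and j = "\<lambda>(x, xs). x # xs"])
       (auto simp: list_all2_Cons1)
  finally show ?case .
qed

text \<open>A monoid homomorphism turns convolution of weights into the product of series once only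
  finitely many tuples lie over each monomial. The sum over these tuples is grouped by their images
  for one side and by their sums for the other.\<close>

lemma has_fprod_push:
  fixes h :: "'b::comm_monoid_add \<Rightarrow> 'a::comm_monoid_add mon"
  assumes h0: "h 0 = 0" and h_add: "\<And>x y. h (x + y) = h x + h y"
    and fin: "\<And>t. finite {xs. list_all2 (\<lambda>w x. w x \<noteq> 0) ws xs \<and> h (sum_list xs) = t}"
    and W: "\<And>x. W x = (\<Sum>xs | list_all2 (\<lambda>w x. w x \<noteq> 0) ws xs \<and> sum_list xs = x.
      prod_list (map2 (\<lambda>w x. w x) ws xs))"
  shows "has_fprod (map (push h) ws) (push h W)"
  unfolding has_fprod_def
proof (intro allI conjI)
  fix t
  define T where "T = {xs. list_all2 (\<lambda>w x. w x \<noteq> 0) ws xs \<and> h (sum_list xs) = t}"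
  define P where "P xs = prod_list (map2 (\<lambda>w x. w x) ws xs)" for xs
  have finT: "finite T" using fin by (simp add: T_def)
  have h_sum: "h (sum_list xs) = sum_list (map h xs)" for xs
    by (induction xs) (simp_all add: h0 h_add)
  have sub: "factorizations (map (push h) ws) t \<subseteq> map h ` T"
  proof
    fix us assume "us \<in> factorizations (map (push h) ws) t"
    then have us: "list_all2 (\<lambda>w u. push h w u \<noteq> 0) ws us" "sum_list us = t"
      by (auto simp: factorizations_def list_all2_map1)
    from us(1) have "\<exists>xs. list_all2 (\<lambda>w x. w x \<noteq> 0) ws xs \<and> map h xs = us"
    proof (induction rule: list_all2_induct)
      case (Cons w ws u us)
      obtain x xs where "w x \<noteq> 0" "h x = u" "list_all2 (\<lambda>w x. w x \<noteq> 0) ws xs" "map h xs = us"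
        using Cons.IH push_nonzeroD[OF Cons(1)] by blast
      then show ?case by (intro exI[of _ "x # xs"]) simp
    qed simp
    then obtain xs where "list_all2 (\<lambda>w x. w x \<noteq> 0) ws xs" "map h xs = us"
      by blast
    with us(2) show "us \<in> map h ` T"
      by (intro image_eqI[of _ _ xs]) (auto simp: T_def h_sum)
  qed
  then show "finite (factorizations (map (push h) ws) t)"
    using finT finite_subset by blast
  have fib: "{xs \<in> T. map h xs = us} = {xs. list_all2 (\<lambda>w x. w x \<noteq> 0) ws xs \<and> map h xs = us}"
    if "us \<in> map h ` T" for us
    using that by (auto simp: T_def h_sum)
  \<comment> \<open>The weights in a fibre may cancel, so the image of a tuple need not be a
    factorization. In that case some factor \<open>push h w u\<close> vanishes, and with it the
    product.\<close>
  have "(\<Sum>us\<in>factorizations (map (push h) ws) t. prod_list (map2 (\<lambda>X u. X u) (map (push h) ws) us))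
      = (\<Sum>us\<in>map h ` T. prod_list (map2 (\<lambda>X u. X u) (map (push h) ws) us))"
  proof (rule sum.mono_neutral_left)
    show "\<forall>us\<in>map h ` T - factorizations (map (push h) ws) t.
        prod_list (map2 (\<lambda>X u. X u) (map (push h) ws) us) = 0"
    proof
      fix us assume us: "us \<in> map h ` T - factorizations (map (push h) ws) t"
      then have len: "length ws = length us" and "sum_list us = t"
        by (auto simp: T_def h_sum list_all2_lengthD)
      then have "\<not> list_all2 (\<lambda>X u. X u \<noteq> 0) (map (push h) ws) us"
        using us by (auto simp: factorizations_def)
      then show "prod_list (map2 (\<lambda>X u. X u) (map (push h) ws) us) = 0"
        using len by (auto simp: list_all2_iff prod_list_zero_iff intro!: rev_image_eqI)
    qed
  qed (use finT sub in auto)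
  also have "\<dots> = (\<Sum>us\<in>map h ` T. \<Sum>xs | xs \<in> T \<and> map h xs = us. P xs)"
  proof (rule sum.cong)
    fix us assume us: "us \<in> map h ` T"
    then have "length ws = length us"
      by (auto simp: T_def list_all2_lengthD)
    then show "prod_list (map2 (\<lambda>X u. X u) (map (push h) ws) us) = (\<Sum>xs | xs \<in> T \<and> map h xs = us. P xs)"
      unfolding P_def fib[OF us] by (rule prod_list_push)
  qed simp
  also have "\<dots> = sum P T"
    using finT by (rule sum.image_gen[symmetric])
  also have "\<dots> = (\<Sum>x\<in>sum_list ` T. \<Sum>xs | xs \<in> T \<and> sum_list xs = x. P xs)"
    using finT by (rule sum.image_gen)
  also have "\<dots> = sum W (sum_list ` T)"
  proof (rule sum.cong)
    fix x assume "x \<in> sum_list ` T"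
    then have "{xs \<in> T. sum_list xs = x} = {xs. list_all2 (\<lambda>w x. w x \<noteq> 0) ws xs \<and> sum_list xs = x}"
      by (auto simp: T_def)
    then show "(\<Sum>xs | xs \<in> T \<and> sum_list xs = x. P xs) = W x"
      unfolding W P_def by simp
  qed simp
  also have "\<dots> = push h W t"
    unfolding push_def
  proof (rule sum.mono_neutral_right)
    show "{x. W x \<noteq> 0 \<and> h x = t} \<subseteq> sum_list ` T"
    proof
      fix x assume x: "x \<in> {x. W x \<noteq> 0 \<and> h x = t}"
      then have "{xs. list_all2 (\<lambda>w x. w x \<noteq> 0) ws xs \<and> sum_list xs = x} \<noteq> {}"
        by (metis (mono_tags, lifting) W mem_Collect_eq sum.empty)
      then show "x \<in> sum_list ` T"
        using x by (auto simp: T_def)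
    qed
  qed (use finT in \<open>auto simp: T_def\<close>)
  finally show "push h W t = (\<Sum>us\<in>factorizations (map (push h) ws) t.
      prod_list (map2 (\<lambda>X u. X u) (map (push h) ws) us))"
    by simp
qed

lemma finite_submultisets: "finite {Y. Y \<subseteq># X}"
proof (rule finite_subset[OF _ finite_multisets_bounded[of "set_mset X" "size X"]])
  show "{Y. Y \<subseteq># X} \<subseteq> {Y. set_mset Y \<subseteq> set_mset X \<and> size Y \<le> size X}"
    using set_mset_mono size_mset_mono by blast
qed simp

text \<open>The components of a decomposition of \<open>X\<close> are among its finitely many
  submultisets, so finite fibres of \<open>h\<close> on a set \<open>Z\<close> containing all
  possible sums are enough.\<close>

lemma has_fprod_push_multisets:
  fixes h :: "'b multiset \<Rightarrow> 'a::comm_monoid_add mon"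
  assumes h0: "h {#} = 0" and h_add: "\<And>x y. h (x + y) = h x + h y"
    and fin: "\<And>t. finite {X \<in> Z. h X = t}"
    and Z: "\<And>xs. list_all2 (\<lambda>w x. w x \<noteq> 0) ws xs \<Longrightarrow> sum_list xs \<in> Z"
    and W: "\<And>x. W x = (\<Sum>xs | list_all2 (\<lambda>w x. w x \<noteq> 0) ws xs \<and> sum_list xs = x.
      prod_list (map2 (\<lambda>w x. w x) ws xs))"
  shows "has_fprod (map (push h) ws) (push h W)"
proof (rule has_fprod_push)
  fix t
  have "{xs. list_all2 (\<lambda>w x. w x \<noteq> 0) ws xs \<and> h (sum_list xs) = t}
      \<subseteq> (\<Union>X\<in>{X \<in> Z. h X = t}. {xs. set xs \<subseteq> {Y. Y \<subseteq># X} \<and> length xs = length ws})"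
  proof
    fix xs assume xs: "xs \<in> {xs. list_all2 (\<lambda>w x. w x \<noteq> 0) ws xs \<and> h (sum_list xs) = t}"
    have "set xs \<subseteq> {Y. Y \<subseteq># sum_list xs}"
      by (induction xs) (auto intro: subset_mset.order_trans)
    then show "xs \<in> (\<Union>X\<in>{X \<in> Z. h X = t}. {xs. set xs \<subseteq> {Y. Y \<subseteq># X} \<and> length xs = length ws})"
      using xs Z[of xs] by (auto dest: list_all2_lengthD intro!: bexI[of _ "sum_list xs"])
  qed
  moreover have "finite (\<Union>X\<in>{X \<in> Z. h X = t}. {xs. set xs \<subseteq> {Y. Y \<subseteq># X} \<and> length xs = length ws})"
    by (intro finite_UN_I fin finite_lists_length_eq finite_submultisets)
  ultimately show "finite {xs. list_all2 (\<lambda>w x. w x \<noteq> 0) ws xs \<and> h (sum_list xs) = t}"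
    by (rule finite_subset)
qed (use h0 h_add W in \<open>simp_all\<close>)

section \<open>Weights on disjoint alphabets\<close>

abbreviation disjoint_list :: "'b set list \<Rightarrow> bool" where
  "disjoint_list \<equiv> sorted_wrt (\<lambda>A B. A \<inter> B = {})"

abbreviation restrict_mset :: "'b multiset \<Rightarrow> 'b set \<Rightarrow> 'b multiset" where
  "restrict_mset X B \<equiv> {#p \<in># X. p \<in> B#}"

lemma list_eq_map_restrict_sum_list:
  assumes "list_all2 (\<lambda>B x. set_mset x \<subseteq> B) Bs xs" "disjoint_list Bs"
  shows "xs = map (restrict_mset (sum_list xs)) Bs"
  using assms
proof (induction rule: list_all2_induct)
  case (Cons B Bs x xs)
  have IH: "xs = map (restrict_mset (sum_list xs)) Bs"
    using Cons by simp
  have "set_mset (sum_list xs) \<subseteq> \<Union> (set Bs)"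
    using Cons(2) by (induction rule: list_all2_induct) auto
  then have "restrict_mset (sum_list xs) B = {#}"
    using Cons.prems by fastforce
  moreover have "restrict_mset x B = {#p \<in># x. True#}"
    using Cons(1) by (intro filter_mset_cong) auto
  moreover have "map (restrict_mset (x + sum_list xs)) Bs = map (restrict_mset (sum_list xs)) Bs"
  proof (rule map_cong)
    fix B' assume "B' \<in> set Bs"
    then have "restrict_mset x B' = {#}"
      using Cons(1) Cons.prems by fastforce
    then show "restrict_mset (x + sum_list xs) B' = restrict_mset (sum_list xs) B'"
      by simp
  qed simp
  ultimately show ?case
    by (simp add: IH[symmetric])
qed simp

lemma sum_list_map_restrict:
  assumes "set_mset X \<subseteq> \<Union> (set Bs)" "disjoint_list Bs"
  shows "sum_list (map (restrict_mset X) Bs) = X"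
  using assms
proof (induction Bs arbitrary: X)
  case (Cons B Bs)
  let ?Y = "{#p \<in># X. p \<notin> B#}"
  have "sum_list (map (restrict_mset ?Y) Bs) = ?Y"
    using Cons.prems by (intro Cons.IH) auto
  moreover have "map (restrict_mset ?Y) Bs = map (restrict_mset X) Bs"
  proof (rule map_cong)
    fix B' assume "B' \<in> set Bs"
    then have "B \<inter> B' = {}" using Cons.prems by simp
    then show "restrict_mset ?Y B' = restrict_mset X B'"
      unfolding filter_filter_mset by (intro filter_mset_cong) auto
  qed simp
  ultimately show ?case
    using multiset_partition[of X "\<lambda>p. p \<in> B"] by simp
qed simp

text \<open>The only candidate for a decomposition of \<open>X\<close> along disjoint alphabets is
  the list of its restrictions, so the sum has at most one term.\<close>

lemma disjoint_convolution:
  fixes ws :: "('b multiset \<Rightarrow> int) list"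
  assumes supp: "list_all2 (\<lambda>B w. \<forall>x. w x \<noteq> 0 \<longrightarrow> set_mset x \<subseteq> B) Bs ws" and dis: "disjoint_list Bs"
  shows "(\<Sum>xs | list_all2 (\<lambda>w x. w x \<noteq> 0) ws xs \<and> sum_list xs = X. prod_list (map2 (\<lambda>w x. w x) ws xs)) =
    (if set_mset X \<subseteq> \<Union> (set Bs) then prod_list (map2 (\<lambda>B w. w (restrict_mset X B)) Bs ws) else 0)"
    (is "sum ?P ?S = _")
proof -
  have alpha: "list_all2 (\<lambda>B x. set_mset x \<subseteq> B) Bs xs" if "list_all2 (\<lambda>w x. w x \<noteq> 0) ws xs" for xs
    by (rule list_all2_trans[OF _ supp that]) blast
  have un: "set_mset (sum_list xs) \<subseteq> \<Union> (set Bs)" if "list_all2 (\<lambda>B x. set_mset x \<subseteq> B) Bs xs" for xs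
    using that by (induction rule: list_all2_induct) auto
  define ys where "ys = map (restrict_mset X) Bs"
  have S: "?S \<subseteq> {ys}"
    using list_eq_map_restrict_sum_list[OF alpha dis] by (auto simp: ys_def)
  have prod: "prod_list (map2 (\<lambda>w x. w x) ws ys) = prod_list (map2 (\<lambda>B w. w (restrict_mset X B)) Bs ws)"
    unfolding ys_def using list_all2_lengthD[OF supp]
    by (induction Bs ws rule: list_induct2) auto
  show ?thesis
  proof (cases "set_mset X \<subseteq> \<Union> (set Bs)")
    case True
    then have sum: "sum_list ys = X"
      unfolding ys_def using dis by (rule sum_list_map_restrict)
    have len: "length ws = length ys"
      using list_all2_lengthD[OF supp] by (simp add: ys_def)
    have "sum ?P ?S = ?P ys"
    proof (cases "list_all2 (\<lambda>w x. w x \<noteq> 0) ws ys")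
      case True
      then have "?S = {ys}" using S sum by auto
      then have "sum ?P ?S = sum ?P {ys}" by (rule arg_cong)
      then show ?thesis by simp
    next
      case False
      then have "?S = {}" using S by auto
      then have "sum ?P ?S = sum ?P {}" by (rule arg_cong)
      moreover have "?P ys = 0"
        using False len by (auto simp: list_all2_iff prod_list_zero_iff intro!: rev_image_eqI)
      ultimately show ?thesis by simp
    qed
    then show ?thesis using True prod by simp
  next
    case False
    then have "?S = {}" using alpha un by blast
    then have "sum ?P ?S = sum ?P {}" by (rule arg_cong)
    then show ?thesis using False by simp
  qed
qed

text \<open>The expansion of the product of \<open>1 + e p\<close> over \<open>p \<in> B\<close>:
  numerators use \<open>e = 1\<close>, denominators \<open>e = -1\<close>.\<close>

definition set_weight :: "'b set \<Rightarrow> int \<Rightarrow> 'b multiset \<Rightarrow> int" where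
  "set_weight B e X = (if set_mset X \<subseteq> B \<and> (\<forall>p. count X p \<le> 1) then e ^ size X else 0)"

text \<open>The expansion of the product of \<open>1 / (1 - p)\<close> over
  \<open>p \<in> B\<close>.\<close>

definition mset_weight :: "'b set \<Rightarrow> 'b multiset \<Rightarrow> int" where
  "mset_weight B X = of_bool (set_mset X \<subseteq> B)"

lemma set_weight_restrict:
  "set_weight B e (restrict_mset X B) = (if \<forall>p\<in>B. count X p \<le> 1 then e ^ size (restrict_mset X B) else 0)"
  by (auto simp: set_weight_def)

lemma set_weight_disjoint_convolution:
  assumes "disjoint_list Bs"
  shows "set_weight (\<Union> (set Bs)) e X = (\<Sum>xs | list_all2 (\<lambda>w x. w x \<noteq> 0) (map (\<lambda>B. set_weight B e) Bs) xs \<and> sum_list xs = X.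
    prod_list (map2 (\<lambda>w x. w x) (map (\<lambda>B. set_weight B e) Bs) xs))"
proof -
  have "list_all2 (\<lambda>B w. \<forall>x. w x \<noteq> 0 \<longrightarrow> set_mset x \<subseteq> B) Bs (map (\<lambda>B. set_weight B e) Bs)"
    by (auto simp: list_all2_map2 set_weight_def intro: list_all2_refl)
  note conv = disjoint_convolution[OF this assms, of X]
  have "prod_list (map2 (\<lambda>B w. w (restrict_mset X B)) Bs (map (\<lambda>B. set_weight B e) Bs))
      = (if \<forall>p\<in>\<Union> (set Bs). count X p \<le> 1 then e ^ size (sum_list (map (restrict_mset X) Bs)) else 0)"
    by (induction Bs) (auto simp: set_weight_restrict power_add)
  moreover have "count X p \<le> 1" if "p \<notin> \<Union> (set Bs)" "set_mset X \<subseteq> \<Union> (set Bs)" for p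
    using that by (metis le0 not_in_iff subsetD)
  ultimately show ?thesis
    unfolding conv using sum_list_map_restrict[OF _ assms, of X] by (auto simp: set_weight_def)
qed

lemma list_all2_pair:
  "list_all2 R [a, b] xs \<longleftrightarrow> (\<exists>x y. xs = [x, y] \<and> R a x \<and> R b y)"
  by (auto simp: list_all2_Cons1)

text \<open>The product of \<open>1 - p\<close> times the product of \<open>1 / (1 - p)\<close> is
  1. A decomposition of \<open>X\<close> amounts to a subset of its support, and the signs of the
  subsets cancel unless the support is empty.\<close>

lemma alternating_convolution:
  "(\<Sum>xs | list_all2 (\<lambda>w x. w x \<noteq> 0) [set_weight B (-1), mset_weight B] xs \<and> sum_list xs = X.
    prod_list (map2 (\<lambda>w x. w x) [set_weight B (-1), mset_weight B] xs)) = of_bool (X = {#})"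
  (is "sum ?P ?S = _")
proof (cases "set_mset X \<subseteq> B")
  case True
  have "sum ?P ?S = (\<Sum>K\<in>Pow (set_mset X). (-1) ^ card K)"
  proof (rule sum.reindex_bij_witness[where i = "\<lambda>K. [mset_set K, X - mset_set K]" and j = "\<lambda>xs. set_mset (hd xs)"])
    fix xs assume "xs \<in> ?S"
    then obtain x y where xy: "xs = [x, y]" "x + y = X" "set_weight B (-1) x \<noteq> 0" "mset_weight B y \<noteq> 0"
      by (auto simp: list_all2_pair)
    have x: "mset_set (set_mset x) = x"
      using xy(3) by (auto simp: set_weight_def count_mset_set' not_in_iff intro!: multiset_eqI split: if_splits)
         (metis One_nat_def Suc_leI count_greater_zero_iff le_antisym)
    show "[mset_set (set_mset (hd xs)), X - mset_set (set_mset (hd xs))] = xs"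
      using x xy by auto
    show "set_mset (hd xs) \<in> Pow (set_mset X)"
      using xy by auto
    have "card (set_mset x) = size x"
      by (metis x size_mset_set)
    then show "(-1) ^ card (set_mset (hd xs)) = ?P xs"
      using xy by (auto simp: set_weight_def mset_weight_def split: if_splits)
  next
    fix K assume K: "K \<in> Pow (set_mset X)"
    then have fK: "finite K" using finite_subset by auto
    show "set_mset (hd [mset_set K, X - mset_set K]) = K"
      using fK by simp
    have sub: "mset_set K \<subseteq># X"
      using K fK by (auto simp: subseteq_mset_def count_mset_set' Suc_le_eq)
    have "set_mset (X - mset_set K) \<subseteq> B"
      using True by (auto dest: in_diffD)
    moreover have "set_weight B (-1) (mset_set K) \<noteq> 0"
      using K fK True by (auto simp: set_weight_def count_mset_set')
    ultimately show "[mset_set K, X - mset_set K] \<in> ?S"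
      using sub by (simp add: mset_weight_def)
  qed
  \<comment> \<open>Expanding the product puts the factors \<open>-1\<close> on the complement of
    the chosen subset, hence the reindexing by complements.\<close>
  also have "\<dots> = (\<Prod>p\<in>set_mset X. 1 + (-1))"
    unfolding prod_add[OF finite_set_mset]
    by (rule sum.reindex_bij_witness[where i = "\<lambda>K. set_mset X - K" and j = "\<lambda>K. set_mset X - K"]) (auto simp: double_diff)
  also have "\<dots> = of_bool (X = {#})"
    by (simp add: card_gt_0_iff)
  finally show ?thesis .
next
  case False
  have "?S = {}"
    using False by (auto simp: list_all2_pair set_weight_def mset_weight_def split: if_splits)
  then have "sum ?P ?S = sum ?P {}" by (rule arg_cong)
  then show ?thesis using False by auto
qed

section \<open>The unit series and the infinite products\<close>

lemma push_empty: "h {#} = 0 \<Longrightarrow> push h (\<lambda>X. of_bool (X = {#})) = fone"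
proof (rule ext)
  fix t assume h: "h {#} = 0"
  have "{X. of_bool (X = {#}) \<noteq> (0::int) \<and> h X = t} = (if t = 0 then {{#}} else {})"
    using h by auto
  then show "push h (\<lambda>X. of_bool (X = {#})) t = fone t"
    by (simp add: push_def fone_def lookup_one when_def)
qed

text \<open>Partial products expand over finite sets of indices, which correspond to the multisets
  in the support of the weight. By \<open>fin\<close> only finitely many of them have the monomial
  \<open>t\<close>, so its coefficient becomes constant; no grading of the exponents is
  involved.\<close>

lemma has_qpoch_push:
  fixes p :: "nat \<Rightarrow> 'b" and g :: "'b \<Rightarrow> 'a::comm_monoid_add mon"
  assumes p: "inj p" and e: "e \<noteq> 0"
    and fin: "\<And>t. finite {X. set_weight (range p) e X \<noteq> 0 \<and> (\<Sum>x\<in>#X. g x) = t}"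
    and factor: "\<And>k. 1 - a * qpow (nmul k S) = 1 + Poly_Mapping.single (g (p k)) e"
  shows "has_qpoch a S (push (\<lambda>X. \<Sum>x\<in>#X. g x) (set_weight (range p) e))"
  unfolding has_qpoch_def
proof
  fix t
  define F where "F = {K. finite K \<and> (\<Sum>k\<in>K. g (p k)) = t}"
  let ?X = "\<lambda>K. mset_set (p ` K)"
  let ?S = "{X. set_weight (range p) e X \<noteq> 0 \<and> (\<Sum>x\<in>#X. g x) = t}"
  have mon: "(\<Sum>x\<in>#?X K. g x) = (\<Sum>k\<in>K. g (p k))" for K
    using p by (simp add: sum_unfold_sum_mset[symmetric] sum.reindex inj_on_subset[OF p])
  have bij: "bij_betw ?X F ?S"
  proof (rule bij_betw_byWitness[where f' = "\<lambda>X. p -` set_mset X"])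
    show "\<forall>K\<in>F. p -` set_mset (?X K) = K"
      using p by (auto simp: F_def inj_vimage_image_eq)
    have X: "?X (p -` set_mset X) = X" "finite (p -` set_mset X)" if "X \<in> ?S" for X
    proof -
      have X: "set_mset X \<subseteq> range p" "\<forall>x. count X x \<le> 1"
        using that by (auto simp: set_weight_def split: if_splits)
      then have "p ` (p -` set_mset X) = set_mset X"
        by auto
      moreover have "count X x = 1" if "x \<in># X" for x
        using X(2) that by (metis Suc_leI One_nat_def count_greater_zero_iff le_antisym)
      ultimately show "?X (p -` set_mset X) = X"
        by (auto simp: count_mset_set' not_in_iff intro!: multiset_eqI)
      show "finite (p -` set_mset X)"
        using p by (intro finite_vimageI) auto
    qed
    then show "\<forall>X\<in>?S. ?X (p -` set_mset X) = X" by blast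
    show "?X ` F \<subseteq> ?S"
      using e mon by (auto simp: F_def set_weight_def count_mset_set')
    show "(\<lambda>X. p -` set_mset X) ` ?S \<subseteq> F"
    proof
      fix K assume "K \<in> (\<lambda>X. p -` set_mset X) ` ?S"
      then obtain X where XS: "X \<in> ?S" "K = p -` set_mset X" by blast
      then show "K \<in> F"
        using X[OF XS(1)] mon[of K] by (simp add: F_def)
    qed
  qed
  then have "finite F"
    using fin[of t] bij_betw_finite by blast
  then have "finite (\<Union>F)"
    by (auto simp: F_def)
  \<comment> \<open>Beyond \<open>n0\<close> no index occurs in a set with monomial
    \<open>t\<close>, so further factors leave the coefficient of \<open>t\<close>
    unchanged.\<close>
  then obtain n0 where n0: "\<forall>k\<in>\<Union>F. k < n0"
    unfolding finite_nat_set_iff_bounded by (rule exE)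
  have "Poly_Mapping.lookup (\<Prod>k<n. 1 - a * qpow (nmul k S)) t
      = push (\<lambda>X. \<Sum>x\<in>#X. g x) (set_weight (range p) e) t" if "n0 \<le> n" for n
  proof -
    have "(\<Prod>k<n. 1 - a * qpow (nmul k S)) = (\<Prod>k<n. Poly_Mapping.single (g (p k)) e + 1)"
      by (simp add: factor add.commute)
    also have "\<dots> = (\<Sum>K\<in>Pow {..<n}. \<Prod>k\<in>K. Poly_Mapping.single (g (p k)) e)"
      by (simp add: prod_add)
    also have "\<dots> = (\<Sum>K\<in>Pow {..<n}. Poly_Mapping.single (\<Sum>k\<in>K. g (p k)) (e ^ card K))"
    proof (rule sum.cong)
      fix K :: "nat set"
      show "(\<Prod>k\<in>K. Poly_Mapping.single (g (p k)) e) = Poly_Mapping.single (\<Sum>k\<in>K. g (p k)) (e ^ card K)"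
        by (induction K rule: infinite_finite_induct) (simp_all add: mult_single)
    qed simp
    finally have "Poly_Mapping.lookup (\<Prod>k<n. 1 - a * qpow (nmul k S)) t
        = (\<Sum>K\<in>Pow {..<n}. if (\<Sum>k\<in>K. g (p k)) = t then e ^ card K else 0)"
      by (simp add: lookup_sum lookup_single when_def)
    also have "\<dots> = (\<Sum>K\<in>F. e ^ card K)"
    proof (rule sum.mono_neutral_cong_right)
      show "F \<subseteq> Pow {..<n}"
        using n0 that by fastforce
    qed (auto simp: F_def intro: finite_subset)
    also have "\<dots> = (\<Sum>K\<in>F. set_weight (range p) e (?X K))"
      by (rule sum.cong) (auto simp: F_def set_weight_def count_mset_set' card_image[OF inj_on_subset[OF p]])
    also have "\<dots> = (\<Sum>X\<in>?S. set_weight (range p) e X)"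
      by (rule sum.reindex_bij_betw[OF bij])
    finally show ?thesis
      by (simp add: push_def)
  qed
  then show "\<forall>\<^sub>F n in sequentially. Poly_Mapping.lookup (\<Prod>k<n. 1 - a * qpow (nmul k S)) t
      = push (\<lambda>X. \<Sum>x\<in>#X. g x) (set_weight (range p) e) t"
    by (auto simp: eventually_sequentially)
qed

text \<open>Products on disjoint ranges of parts multiply to the expansion over the union.
  Finiteness on the union also gives the convergence of each single product, whose support is
  contained in that of the union.\<close>

lemma has_qpochs_push:
  fixes p :: "nat \<Rightarrow> nat \<Rightarrow> 'b" and g :: "'b \<Rightarrow> 'a::comm_monoid_add mon"
  defines "U js \<equiv> (\<Union>j\<in>set js. range (p j))"
  assumes dis: "disjoint_list (map (\<lambda>j. range (p j)) js)" and inj: "\<And>j. j \<in> set js \<Longrightarrow> inj (p j)"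
    and e: "e \<noteq> 0"
    and fin: "\<And>t. finite {X. set_weight (U js) e X \<noteq> 0 \<and> (\<Sum>x\<in>#X. g x) = t}"
    and factor: "\<And>j k. j \<in> set js \<Longrightarrow> 1 - a j * qpow (nmul k S) = 1 + Poly_Mapping.single (g (p j k)) e"
  shows "has_qpochs (map a js) S (push (\<lambda>X. \<Sum>x\<in>#X. g x) (set_weight (U js) e))"
proof -
  let ?h = "\<lambda>X. \<Sum>x\<in>#X. g x" and ?Bs = "map (\<lambda>j. range (p j)) js"
  have U: "U js = \<Union> (set ?Bs)" by (simp add: U_def)
  have "has_qpoch (a j) S (push ?h (set_weight (range (p j)) e))" if j: "j \<in> set js" for j
  proof (rule has_qpoch_push[OF inj[OF j] e _ factor[OF j]])
    fix t
    show "finite {X. set_weight (range (p j)) e X \<noteq> 0 \<and> ?h X = t}"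
    proof (rule finite_subset[OF _ fin])
      show "{X. set_weight (range (p j)) e X \<noteq> 0 \<and> ?h X = t} \<subseteq> {X. set_weight (U js) e X \<noteq> 0 \<and> ?h X = t}"
        using j e by (auto simp: set_weight_def U_def split: if_splits)
    qed
  qed
  then have "list_all2 (\<lambda>a Y. has_qpoch a S Y) (map a js) (map (push ?h) (map (\<lambda>B. set_weight B e) ?Bs))"
    by (simp add: list_all2_map1 list_all2_map2 list_all2_same)
  moreover have "has_fprod (map (push ?h) (map (\<lambda>B. set_weight B e) ?Bs)) (push ?h (set_weight (U js) e))"
  proof (rule has_fprod_push_multisets[where Z = "{X. set_weight (U js) e X \<noteq> 0}"])
    \<comment> \<open>Multiplicities stay at most one in the sum because an element can occur in
      only one of the disjoint alphabets.\<close>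
    have *: "set_weight (\<Union> (set Bs)) e (sum_list xs) \<noteq> 0"
      if "list_all2 (\<lambda>B x. set_weight B e x \<noteq> 0) Bs xs" "disjoint_list Bs" for Bs :: "'b set list" and xs
      using that
    proof (induction rule: list_all2_induct)
      case Nil
      show ?case by (simp add: set_weight_def)
    next
      case (Cons B Bs x xs)
      have x: "set_mset x \<subseteq> B" "\<And>q. count x q \<le> 1"
        using Cons(1) by (auto simp: set_weight_def split: if_splits)
      have xs: "set_mset (sum_list xs) \<subseteq> \<Union> (set Bs)" "\<And>q. count (sum_list xs) q \<le> 1"
        using Cons by (auto simp: set_weight_def split: if_splits)
      have "count x q + count (sum_list xs) q \<le> 1" for q
      proof (cases "q \<in> B")
        case True
        then have "q \<notin> set_mset (sum_list xs)" using xs(1) Cons.prems by fastforce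
        then have "count (sum_list xs) q = 0" by (rule not_in_iff[THEN iffD1])
        then show ?thesis using x(2)[of q] by simp
      next
        case False
        then have "q \<notin># x" using x(1) by auto
        then show ?thesis using xs(2)[of q] by (simp add: not_in_iff)
      qed
      then show ?case
        using x(1) xs(1) e by (auto simp: set_weight_def)
    qed
    show "sum_list xs \<in> {X. set_weight (U js) e X \<noteq> 0}"
      if "list_all2 (\<lambda>w x. w x \<noteq> 0) (map (\<lambda>B. set_weight B e) ?Bs) xs" for xs
    proof -
      have "list_all2 (\<lambda>B x. set_weight B e x \<noteq> 0) ?Bs xs"
        using that by (simp add: list_all2_map1)
      from *[OF this dis] show ?thesis
        by (simp only: mem_Collect_eq U not_False_eq_True)
    qed
    show "finite {X \<in> {X. set_weight (U js) e X \<noteq> 0}. ?h X = t}" for t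
      using fin[of t] by simp
    show "set_weight (U js) e X = (\<Sum>xs | list_all2 (\<lambda>w x. w x \<noteq> 0) (map (\<lambda>B. set_weight B e) ?Bs) xs \<and> sum_list xs = X.
      prod_list (map2 (\<lambda>w x. w x) (map (\<lambda>B. set_weight B e) ?Bs) xs))" for X
      unfolding U by (rule set_weight_disjoint_convolution[OF dis])
  qed simp_all
  ultimately show ?thesis
    unfolding has_qpochs_def by blast
qed

section \<open>The two alphabets and the products over them\<close>

definition num_letters :: "nat \<Rightarrow> part set" where
  "num_letters m = {Num x | x. \<not> m dvd x}"

definition over_letters :: "part set" where
  "over_letters = {Over x | x. 0 < x}"

lemma num_over_disjoint: "num_letters m \<inter> over_letters = {}"
  by (auto simp: num_letters_def over_letters_def)

text \<open>In this form a regular multiset is a set over one alphabet together with a multiset over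
  the other, which is what the numerator and the inverse of the denominator enumerate.\<close>

lemma regular_omsets_iff:
  "X \<in> regular_omsets m \<longleftrightarrow> set_mset X \<subseteq> over_letters \<union> num_letters m \<and> (\<forall>p\<in>over_letters. count X p \<le> 1)"
proof
  assume X: "X \<in> regular_omsets m"
  have "p \<in> over_letters \<union> num_letters m" if "p \<in># X" for p
    using X that by (cases p) (auto simp: regular_omsets_def omsets_def over_letters_def num_letters_def)
  then show "set_mset X \<subseteq> over_letters \<union> num_letters m \<and> (\<forall>p\<in>over_letters. count X p \<le> 1)"
    using X by (auto simp: regular_omsets_def omsets_def over_letters_def)
next
  assume X: "set_mset X \<subseteq> over_letters \<union> num_letters m \<and> (\<forall>p\<in>over_letters. count X p \<le> 1)"
  have "count X (Over n) \<le> 1" for n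
  proof (cases "n = 0")
    case True
    then have "Over n \<notin># X"
      using X by (auto simp: over_letters_def num_letters_def)
    then show ?thesis by (simp add: not_in_iff)
  next
    case False
    then show ?thesis using X by (auto simp: over_letters_def)
  qed
  then show "X \<in> regular_omsets m"
    using X by (auto simp: regular_omsets_def omsets_def over_letters_def num_letters_def intro!: gr0I)
qed

lemma num_letters_eq:
  assumes "1 \<le> m"
  shows "num_letters m = (\<Union>j\<in>set [1..<m]. range (\<lambda>k. Num (j + k * m)))"
proof (intro set_eqI iffI)
  fix p assume "p \<in> num_letters m"
  then obtain x where x: "p = Num x" "\<not> m dvd x" by (auto simp: num_letters_def)
  then have "x mod m \<in> set [1..<m]" "p = Num (x mod m + (x div m) * m)"
    using assms by (auto simp: mod_eq_0_iff_dvd Suc_le_eq intro!: gr0I)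
  then show "p \<in> (\<Union>j\<in>set [1..<m]. range (\<lambda>k. Num (j + k * m)))" by blast
next
  fix p assume "p \<in> (\<Union>j\<in>set [1..<m]. range (\<lambda>k. Num (j + k * m)))"
  then show "p \<in> num_letters m"
    by (auto simp: num_letters_def dvd_add_left_iff nat_dvd_not_less)
qed

lemma over_letters_eq:
  assumes "1 \<le> m"
  shows "over_letters = (\<Union>j\<in>set [1..<m + 1]. range (\<lambda>k. Over (j + k * m)))"
proof (intro set_eqI iffI)
  fix p assume "p \<in> over_letters"
  then obtain x where x: "p = Over x" "0 < x" by (auto simp: over_letters_def)
  define j where "j = (if m dvd x then m else x mod m)"
  have j: "j \<in> set [1..<m + 1]"
    using assms mod_less_divisor[of m x] by (auto simp: j_def mod_eq_0_iff_dvd Suc_le_eq less_Suc_eq intro!: gr0I)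
  then obtain k where "x = j + k * m"
    using ex_residue_iff[of j m x] x by (auto simp: j_def)
  then show "p \<in> (\<Union>j\<in>set [1..<m + 1]. range (\<lambda>k. Over (j + k * m)))"
    using x j by blast
qed (auto simp: over_letters_def)

text \<open>Numbers in \<open>{1..m}\<close> are pairwise incongruent modulo \<open>m\<close>. The
  bound on \<open>n\<close> admits both \<open>[1..<m]\<close> and
  \<open>[1..<m + 1]\<close>.\<close>

lemma disjoint_residue_classes:
  assumes "inj f" "n \<le> m + 1"
  shows "disjoint_list (map (\<lambda>j. range (\<lambda>k. f (j + k * m))) [1..<n])"
proof -
  have residue: "i = j" if "1 \<le> i" "i \<le> m" "1 \<le> j" "j \<le> m" "i + k * m = j + l * m" for i j k l :: nat
  proof -
    let ?r = "if m dvd i + k * m then m else (i + k * m) mod m"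
    have "i = ?r"
      by (rule iffD1[OF ex_residue_iff]) (use that(1,2) in auto)
    moreover have "j = ?r"
      by (rule iffD1[OF ex_residue_iff]) (use that in \<open>auto intro: exI[of _ l]\<close>)
    ultimately show ?thesis by (rule trans[OF _ sym])
  qed
  show ?thesis
    unfolding sorted_wrt_map
    unfolding sorted_wrt_iff_nth_less
  proof (intro allI impI)
    fix x y assume xy: "x < y" "y < length [1..<n]"
    have "f (1 + x + k * m) \<noteq> f (1 + y + l * m)" for k l
    proof
      assume "f (1 + x + k * m) = f (1 + y + l * m)"
      then have "1 + x + k * m = 1 + y + l * m"
        by (rule injD[OF assms(1)])
      then have "1 + x = 1 + y"
        by (rule residue[rotated 4]) (use xy assms(2) in auto)
      then show False using xy by simp
    qed
    then show "range (\<lambda>k. f ([1..<n] ! x + k * m)) \<inter> range (\<lambda>k. f ([1..<n] ! y + k * m)) = {}"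
      using xy by auto
  qed
qed

lemma mset_mon_eq_sum: "mset_mon m s = (\<lambda>X. \<Sum>p\<in>#X. part_mon m s p)"
  by (simp add: fun_eq_iff mset_mon_def)

text \<open>The part \<open>j + k * m\<close> accounts for the factor with index \<open>k\<close> in
  the product that starts with colour \<open>j\<close>.\<close>

lemma part_mon_Num:
  assumes "\<forall>i\<ge>1. s (i + m) = s i" "j \<in> set [1..<m]"
  shows "part_mon m s (Num (j + k * m)) = (Poly_Mapping.single (C j) 1, psum s j + nmul k (psum s m))"
  using assms(2) psum_add_period[OF assms(1), of j k]
  by (auto simp: part_mon_def dvd_add_left_iff dest: dvd_imp_le)

lemma part_mon_Over:
  assumes "\<forall>i\<ge>1. s (i + m) = s i" "j \<in> set [1..<m + 1]"
  shows "part_mon m s (Over (j + k * m)) = (Poly_Mapping.single (Cbar j) 1, psum s j + nmul k (psum s m))"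
proof -
  have "(if m dvd j + k * m then m else (j + k * m) mod m) = j"
    using ex_residue_iff[of j m "j + k * m"] assms(2) by auto
  then show ?thesis
    using psum_add_period[OF assms(1), of j k] by (simp add: part_mon_def)
qed

lemma has_qpochs_over:
  assumes m: "1 \<le> m" and s: "\<forall>i\<ge>1. s (i + m) = s i"
    and fin: "\<And>t. finite {X \<in> regular_omsets m. set_mset X \<subseteq> over_letters \<and> mset_mon m s X = t}"
  shows "has_qpochs (map (\<lambda>j. - (colbar j * qpow (psum s j))) [1..<m + 1]) (psum s m)
    (push (mset_mon m s) (set_weight over_letters 1))"
  unfolding over_letters_eq[OF m] mset_mon_eq_sum
proof (rule has_qpochs_push)
  show "disjoint_list (map (\<lambda>j. range (\<lambda>k. Over (j + k * m))) [1..<m + 1])"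
    by (rule disjoint_residue_classes) (auto simp: inj_def)
  show "inj (\<lambda>k. Over (j + k * m))" for j
    by (rule inj_progression(2)[OF m])
  show "finite {X. set_weight (\<Union>j\<in>set [1..<m + 1]. range (\<lambda>k. Over (j + k * m))) 1 X \<noteq> 0 \<and>
      (\<Sum>p\<in>#X. part_mon m s p) = t}" for t
    unfolding over_letters_eq[OF m, symmetric]
    by (rule finite_subset[OF _ fin[of t]])
       (auto simp: set_weight_def regular_omsets_iff mset_mon_def split: if_splits)
  show "1 - - (colbar j * qpow (psum s j)) * qpow (nmul k (psum s m))
      = 1 + Poly_Mapping.single (part_mon m s (Over (j + k * m))) 1" if "j \<in> set [1..<m + 1]" for j k
    by (simp add: part_mon_Over[OF s that] colbar_def qpow_def mult_single)
qed simp

lemma has_qpochs_num: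
  assumes m: "1 \<le> m" and s: "\<forall>i\<ge>1. s (i + m) = s i"
    and fin: "\<And>t. finite {X \<in> regular_omsets m. set_mset X \<subseteq> num_letters m \<and> mset_mon m s X = t}"
  shows "has_qpochs (map (\<lambda>j. col j * qpow (psum s j)) [1..<m]) (psum s m)
    (push (mset_mon m s) (set_weight (num_letters m) (-1)))"
  unfolding num_letters_eq[OF m] mset_mon_eq_sum
proof (rule has_qpochs_push)
  show "disjoint_list (map (\<lambda>j. range (\<lambda>k. Num (j + k * m))) [1..<m])"
    by (rule disjoint_residue_classes) (auto simp: inj_def)
  show "inj (\<lambda>k. Num (j + k * m))" for j
    by (rule inj_progression(1)[OF m])
  show "finite {X. set_weight (\<Union>j\<in>set [1..<m]. range (\<lambda>k. Num (j + k * m))) (- 1) X \<noteq> 0 \<and>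
      (\<Sum>p\<in>#X. part_mon m s p) = t}" for t
    unfolding num_letters_eq[OF m, symmetric]
    by (rule finite_subset[OF _ fin[of t]])
       (auto simp: set_weight_def regular_omsets_iff mset_mon_def split: if_splits)
  show "1 - col j * qpow (psum s j) * qpow (nmul k (psum s m))
      = 1 + Poly_Mapping.single (part_mon m s (Num (j + k * m))) (- 1)" if "j \<in> set [1..<m]" for j k
    by (simp add: part_mon_Num[OF s that] col_def qpow_def mult_single single_uminus)
qed simp

lemma num_multisets_regular: "set_mset X \<subseteq> num_letters m \<Longrightarrow> X \<in> regular_omsets m"
proof -
  assume X: "set_mset X \<subseteq> num_letters m"
  then have "count X p = 0" if "p \<in> over_letters" for p
    using that num_over_disjoint[of m] by (auto simp: count_eq_zero_iff)
  then show "X \<in> regular_omsets m"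
    using X by (auto simp: regular_omsets_iff)
qed

text \<open>Supplies the inverse \<open>E\<close> demanded by \<open>has_fquot\<close>.\<close>

lemma has_fprod_inverse:
  assumes fin: "\<And>t. finite {X \<in> regular_omsets m. set_mset X \<subseteq> num_letters m \<and> mset_mon m s X = t}"
  shows "has_fprod [push (mset_mon m s) (set_weight (num_letters m) (-1)), push (mset_mon m s) (mset_weight (num_letters m))] fone"
proof -
  have "has_fprod (map (push (mset_mon m s)) [set_weight (num_letters m) (-1), mset_weight (num_letters m)])
      (push (mset_mon m s) (\<lambda>X. of_bool (X = {#})))"
  proof (rule has_fprod_push_multisets[where Z = "{X. set_mset X \<subseteq> num_letters m}"])
    show "finite {X \<in> {X. set_mset X \<subseteq> num_letters m}. mset_mon m s X = t}" for t
      by (rule finite_subset[OF _ fin[of t]]) (auto simp: num_multisets_regular)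
    show "sum_list xs \<in> {X. set_mset X \<subseteq> num_letters m}"
      if "list_all2 (\<lambda>w x. w x \<noteq> 0) [set_weight (num_letters m) (-1), mset_weight (num_letters m)] xs" for xs
      using that unfolding list_all2_pair by (auto simp: set_weight_def mset_weight_def split: if_splits)
  qed (simp_all only: mset_mon_empty mset_mon_plus alternating_convolution)
  then show ?thesis by (simp add: push_empty)
qed

lemma has_fprod_over_num:
  assumes fin: "\<And>t. finite {X \<in> regular_omsets m. mset_mon m s X = t}"
  shows "has_fprod [push (mset_mon m s) (set_weight over_letters 1), push (mset_mon m s) (mset_weight (num_letters m))]
    (push (mset_mon m s) (\<lambda>X. of_bool (X \<in> regular_omsets m)))"
proof -
  have "has_fprod (map (push (mset_mon m s)) [set_weight over_letters 1, mset_weight (num_letters m)])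
    (push (mset_mon m s) (\<lambda>X. of_bool (X \<in> regular_omsets m)))"
  proof (rule has_fprod_push_multisets[where Z = "regular_omsets m"])
    show "sum_list xs \<in> regular_omsets m"
      if "list_all2 (\<lambda>w x. w x \<noteq> 0) [set_weight over_letters 1, mset_weight (num_letters m)] xs" for xs
    proof -
      obtain x y where xy: "xs = [x, y]" "set_mset x \<subseteq> over_letters" "\<And>p. count x p \<le> 1" "set_mset y \<subseteq> num_letters m"
        using \<open>list_all2 _ _ xs\<close> unfolding list_all2_pair by (auto simp: set_weight_def mset_weight_def split: if_splits)
      then have "count y p = 0" if "p \<in> over_letters" for p
        using that num_over_disjoint[of m] by (auto simp: count_eq_zero_iff)
      then show ?thesis
        using xy by (auto simp: regular_omsets_iff)
    qed
    fix X
    have "(\<Sum>xs | list_all2 (\<lambda>w x. w x \<noteq> 0) [set_weight over_letters 1, mset_weight (num_letters m)] xs \<and> sum_list xs = X.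
        prod_list (map2 (\<lambda>w x. w x) [set_weight over_letters 1, mset_weight (num_letters m)] xs)) =
      (if set_mset X \<subseteq> \<Union> (set [over_letters, num_letters m]) then prod_list (map2 (\<lambda>B w. w (restrict_mset X B))
        [over_letters, num_letters m] [set_weight over_letters 1, mset_weight (num_letters m)]) else 0)"
      using num_over_disjoint[of m]
      by (intro disjoint_convolution) (auto simp: set_weight_def mset_weight_def split: if_splits)
    also have "\<dots> = of_bool (X \<in> regular_omsets m)"
      by (auto simp: regular_omsets_iff set_weight_restrict mset_weight_def)
    finally show "of_bool (X \<in> regular_omsets m) =
      (\<Sum>xs | list_all2 (\<lambda>w x. w x \<noteq> 0) [set_weight over_letters 1, mset_weight (num_letters m)] xs \<and> sum_list xs = X.
        prod_list (map2 (\<lambda>w x. w x) [set_weight over_letters 1, mset_weight (num_letters m)] xs))" by (rule sym)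
  qed (use fin in simp_all)
  then show ?thesis by simp
qed

lemma has_fprod_fone_num:
  assumes fin: "\<And>t. finite {X \<in> regular_omsets m. set_mset X \<subseteq> num_letters m \<and> mset_mon m s X = t}"
  shows "has_fprod [fone, push (mset_mon m s) (mset_weight (num_letters m))] (push (mset_mon m s) (mset_weight (num_letters m)))"
proof -
  let ?d = "\<lambda>X :: part multiset. of_bool (X = {#}) :: int"
  have "has_fprod (map (push (mset_mon m s)) [?d, mset_weight (num_letters m)]) (push (mset_mon m s) (mset_weight (num_letters m)))"
  proof (rule has_fprod_push_multisets[where Z = "{X. set_mset X \<subseteq> num_letters m}"])
    show "finite {X \<in> {X. set_mset X \<subseteq> num_letters m}. mset_mon m s X = t}" for t
      by (rule finite_subset[OF _ fin[of t]]) (auto simp: num_multisets_regular)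
    show "sum_list xs \<in> {X. set_mset X \<subseteq> num_letters m}"
      if "list_all2 (\<lambda>w x. w x \<noteq> 0) [?d, mset_weight (num_letters m)] xs" for xs
      using that unfolding list_all2_pair by (auto simp: mset_weight_def)
    fix X
    \<comment> \<open>The unit is treated as a weight over the empty alphabet, which is disjoint
      from every other one.\<close>
    have "(\<Sum>xs | list_all2 (\<lambda>w x. w x \<noteq> 0) [?d, mset_weight (num_letters m)] xs \<and> sum_list xs = X.
        prod_list (map2 (\<lambda>w x. w x) [?d, mset_weight (num_letters m)] xs)) =
      (if set_mset X \<subseteq> \<Union> (set [{}, num_letters m]) then prod_list (map2 (\<lambda>B w. w (restrict_mset X B))
        [{}, num_letters m] [?d, mset_weight (num_letters m)]) else 0)"
      by (intro disjoint_convolution) (auto simp: mset_weight_def)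
    also have "\<dots> = mset_weight (num_letters m) X"
      by (auto simp: mset_weight_def)
    finally show "mset_weight (num_letters m) X = (\<Sum>xs | list_all2 (\<lambda>w x. w x \<noteq> 0) [?d, mset_weight (num_letters m)] xs \<and> sum_list xs = X.
        prod_list (map2 (\<lambda>w x. w x) [?d, mset_weight (num_letters m)] xs))" by (rule sym)
  qed simp_all
  then show ?thesis by (simp add: push_empty)
qed

section \<open>Transport of sums and of the three families\<close>

lemma bij_betw_Collect:
  assumes "bij_betw f A B" "\<And>x. x \<in> A \<Longrightarrow> P x \<longleftrightarrow> Q (f x)"
  shows "bij_betw f {x \<in> A. P x} {y \<in> B. Q y}"
  using assms by (auto simp: bij_betw_def inj_on_def)

text \<open>All summands are monomials with coefficient 1, so nothing can cancel and summability
  amounts to finiteness of the fibres.\<close>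

lemma fsum_eq_push:
  assumes \<theta>: "bij_betw \<theta> L R" and F: "\<And>l. l \<in> L \<Longrightarrow> F l = Poly_Mapping.single (h (\<theta> l)) 1"
  shows "fsummable L F \<longleftrightarrow> (\<forall>t. finite {X \<in> R. h X = t})"
    and "fsum L F = push h (\<lambda>X. of_bool (X \<in> R))"
proof -
  have set_eq: "{l \<in> L. Poly_Mapping.lookup (F l) t \<noteq> 0} = {l \<in> L. h (\<theta> l) = t}" for t
    using F by (auto simp: lookup_single when_def split: if_splits)
  have bij: "bij_betw \<theta> {l \<in> L. h (\<theta> l) = t} {X \<in> R. h X = t}" for t
    by (rule bij_betw_Collect[OF \<theta>]) simp
  show "fsummable L F \<longleftrightarrow> (\<forall>t. finite {X \<in> R. h X = t})"
    unfolding fsummable_def set_eq using bij_betw_finite[OF bij] by simp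
  show "fsum L F = push h (\<lambda>X. of_bool (X \<in> R))"
  proof
    fix t
    have "fsum L F t = (\<Sum>l\<in>{l \<in> L. h (\<theta> l) = t}. 1)"
      unfolding fsum_def set_eq using F by (intro sum.cong) auto
    also have "\<dots> = (\<Sum>X\<in>{X \<in> R. h X = t}. 1)"
      using bij_betw_same_card[OF bij] by simp
    also have "\<dots> = push h (\<lambda>X. of_bool (X \<in> R)) t"
      unfolding push_def by (intro sum.cong) auto
    finally show "fsum L F t = push h (\<lambda>X. of_bool (X \<in> R)) t" .
  qed
qed

text \<open>Makes the absence of over-lined parts depend on \<open>letters\<close> only, so that the
  bijection respects the restriction to \<open>Pset\<close>.\<close>

lemma ex_Over_letters: "(\<exists>n. Over n \<in># letters m X) \<longleftrightarrow> (\<exists>n. Over n \<in># X)"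
proof
  assume "\<exists>n. Over n \<in># letters m X"
  then obtain p where "p \<in># X" "is_over (letter m p)" by (auto simp: letters_def) (metis is_over.simps(2))
  then show "\<exists>n. Over n \<in># X"
    by (cases p) (auto simp: letter_def)
next
  assume "\<exists>n. Over n \<in># X"
  then obtain n where "Over n \<in># X" by blast
  then have "Over (n mod m) \<in># letters m X"
    by (auto simp: letters_def letter_def intro!: image_eqI[of _ _ "Over n"])
  then show "\<exists>n. Over n \<in># letters m X" by blast
qed

text \<open>The counterpart for \<open>Fbar\<close>; multiples of \<open>m\<close> leave no trace,
  as \<open>letters\<close> drops \<open>Num 0\<close>.\<close>

lemma ex_Num_letters: "(\<exists>n. Num n \<in># letters m X) \<longleftrightarrow> (\<exists>n. Num n \<in># X \<and> \<not> m dvd n)"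
proof
  assume "\<exists>n. Num n \<in># letters m X"
  then obtain n p where p: "p \<in># X" "Num n = letter m p" "n \<noteq> 0"
    by (auto simp: letters_def)
  then show "\<exists>n. Num n \<in># X \<and> \<not> m dvd n"
    by (cases p) (auto simp: letter_def mod_eq_0_iff_dvd)
next
  assume "\<exists>n. Num n \<in># X \<and> \<not> m dvd n"
  then obtain n where "Num n \<in># X" "\<not> m dvd n" by blast
  then have "Num (n mod m) \<in># letters m X"
    by (auto simp: letters_def letter_def mod_eq_0_iff_dvd intro!: image_eqI[of _ _ "Num n"])
  then show "\<exists>n. Num n \<in># letters m X" by blast
qed

lemma regular_subset_num:
  assumes "X \<in> regular_omsets m"
  shows "set_mset X \<subseteq> num_letters m \<longleftrightarrow> \<not> (\<exists>n. Over n \<in># X)"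
  using assms by (auto simp: regular_omsets_iff num_letters_def over_letters_def)

lemma regular_subset_over:
  assumes "X \<in> regular_omsets m"
  shows "set_mset X \<subseteq> over_letters \<longleftrightarrow> \<not> (\<exists>n. Num n \<in># X \<and> \<not> m dvd n)"
  using assms by (auto simp: regular_omsets_iff num_letters_def over_letters_def)

lemma ex_Pbar_bij:
  fixes s :: "nat \<Rightarrow> 'a::comm_monoid_add"
  assumes m: "1 \<le> m" and s: "\<forall>i\<ge>1. s (i + m) = s i"
  obtains \<theta> where "bij_betw \<theta> (Pbar m) (regular_omsets m)"
    and "\<And>l. l \<in> Pbar m \<Longrightarrow> term_Pbar m s l = Poly_Mapping.single (mset_mon m s (\<theta> l)) 1"
    and "\<And>l. l \<in> Pbar m \<Longrightarrow> l \<in> Pset m \<longleftrightarrow> set_mset (\<theta> l) \<subseteq> num_letters m"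
    and "\<And>l. l \<in> Pbar m \<Longrightarrow> l \<in> Fbar m \<longleftrightarrow> set_mset (\<theta> l) \<subseteq> over_letters"
proof -
  obtain f where f: "bij_betw f (glaisher_omsets m) (regular_omsets m)"
    and stat: "\<And>V. V \<in> glaisher_omsets m \<Longrightarrow>
       letters m (f V) = letters m (star V) \<and> wraps m (f V) = wraps m (star V)"
    using ex_stat_preserving_bij[OF m] by blast
  define g where "g V = conjugate (star V)" for V
  have gsub: "V \<in> omsets" if "V \<in> glaisher_omsets m" for V
    using that by (simp add: glaisher_omsets_def)
  have "inj_on g omsets"
    unfolding g_def
    by (intro inj_onI) (metis conjugate_inj inj_onD star_in_omsets star_star)
  then have g: "bij_betw g (glaisher_omsets m) (Pbar m)"
    unfolding bij_betw_def image_conjugate_star_Pbar g_def[symmetric] glaisher_omsets_def[symmetric]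
    using gsub by (auto intro: inj_on_subset)
  define \<theta> where "\<theta> = f \<circ> inv_into (glaisher_omsets m) g"
  have bij: "bij_betw \<theta> (Pbar m) (regular_omsets m)"
    unfolding \<theta>_def by (rule bij_betw_trans[OF bij_betw_inv_into[OF g] f])
  have \<theta>g: "\<theta> (g V) = f V" if "V \<in> glaisher_omsets m" for V
    using bij_betw_inv_into_left[OF g that] by (simp add: \<theta>_def)
  have main: "term_Pbar m s (g V) = Poly_Mapping.single (mset_mon m s (f V)) 1 \<and>
      (g V \<in> Pset m \<longleftrightarrow> set_mset (f V) \<subseteq> num_letters m) \<and>
      (g V \<in> Fbar m \<longleftrightarrow> set_mset (f V) \<subseteq> over_letters)" if V: "V \<in> glaisher_omsets m" for V
  proof (intro conjI)
    have sV: "star V \<in> omsets" using star_in_omsets gsub V by blast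
    have fV: "f V \<in> regular_omsets m" using bij_betwE[OF f] V by blast
    have gP: "g V \<in> Pbar m" using bij_betwE[OF g] V by blast
    have "mset_mon m s (star V) = mset_mon m s (f V)"
      unfolding mset_mon_stat[OF s, of "star V"] mset_mon_stat[OF s, of "f V"] using stat[OF V] by simp
    then show "term_Pbar m s (g V) = Poly_Mapping.single (mset_mon m s (f V)) 1"
      by (simp add: g_def term_Pbar_conjugate[OF sV m])
    have "g V \<in> Pset m \<longleftrightarrow> (\<forall>i\<ge>1. Over i \<notin># star V)"
      using gP by (simp add: Pset_def g_def)
    also have "\<dots> \<longleftrightarrow> \<not> (\<exists>i. Over i \<in># star V)"
      using omsets_pos[OF sV] by (metis One_nat_def Suc_leI psize.simps(2))
    also have "\<dots> \<longleftrightarrow> \<not> (\<exists>i. Over i \<in># f V)"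
      using stat[OF V] ex_Over_letters[of m "star V"] ex_Over_letters[of m "f V"] by simp
    also have "\<dots> \<longleftrightarrow> set_mset (f V) \<subseteq> num_letters m"
      by (rule regular_subset_num[OF fV, symmetric])
    finally show "g V \<in> Pset m \<longleftrightarrow> set_mset (f V) \<subseteq> num_letters m" .
    \<comment> \<open>By the recurrence, the difference exceeds the mark by the multiplicity of
      \<open>Num i\<close>. The condition of \<open>Fbar\<close> at \<open>i\<close> therefore says
      that \<open>Num i\<close> does not occur in the conjugate.\<close>
    have "int (num_ge (star V) i) - int (num_ge (star V) (i + 1)) = of_bool (Over i \<in># star V)
        \<longleftrightarrow> Num i \<notin># star V" for i
      using num_ge_Suc_omset[OF sV, of i] by (simp add: not_in_iff)
    then have "g V \<in> Fbar m \<longleftrightarrow> (\<forall>i\<ge>1. \<not> m dvd i \<longrightarrow> Num i \<notin># star V)"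
      using gP by (simp add: Fbar_def g_def)
    also have "\<dots> \<longleftrightarrow> \<not> (\<exists>i. Num i \<in># star V \<and> \<not> m dvd i)"
      by (metis One_nat_def Suc_leI dvd_0_right gr0I)
    also have "\<dots> \<longleftrightarrow> \<not> (\<exists>i. Num i \<in># f V \<and> \<not> m dvd i)"
      using stat[OF V] ex_Num_letters[of m "star V"] ex_Num_letters[of m "f V"] by simp
    also have "\<dots> \<longleftrightarrow> set_mset (f V) \<subseteq> over_letters"
      by (rule regular_subset_over[OF fV, symmetric])
    finally show "g V \<in> Fbar m \<longleftrightarrow> set_mset (f V) \<subseteq> over_letters" .
  qed
  have main': "term_Pbar m s l = Poly_Mapping.single (mset_mon m s (\<theta> l)) 1 \<and>
      (l \<in> Pset m \<longleftrightarrow> set_mset (\<theta> l) \<subseteq> num_letters m) \<and>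
      (l \<in> Fbar m \<longleftrightarrow> set_mset (\<theta> l) \<subseteq> over_letters)" if "l \<in> Pbar m" for l
  proof -
    have "l \<in> g ` glaisher_omsets m"
      using that g by (simp add: bij_betw_def)
    then obtain V where "l = g V" "V \<in> glaisher_omsets m"
      by (rule imageE)
    then show ?thesis using main[of V] \<theta>g[of V] by simp
  qed
  show thesis
    using that[OF bij] main' by blast
qed

lemma term_P_eq_term_Pbar:
  assumes "l \<in> Pset m" "1 \<le> m"
  shows "term_P m s l = term_Pbar m s l"
proof -
  have "rhobar m j l = 0" if "1 \<le> j" for j
    using assms(1) that by (simp add: rhobar_def Pset_def trans_le_add1)
  then show ?thesis
    using assms(2) by (simp add: term_P_def term_Pbar_def)
qed

text \<open>For \<open>j < m\<close> no index \<open>j + i * m\<close> is divisible by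
  \<open>m\<close>, so all summands of \<open>rho m j l\<close> vanish. At multiples of
  \<open>m\<close> the difference is free, but no colour records it.\<close>

lemma term_F_eq_term_Pbar:
  assumes "l \<in> Fbar m" "1 \<le> m"
  shows "term_F m s l = term_Pbar m s l"
proof -
  have "rho m j l = 0" if j: "1 \<le> j" "j < m" for j
  proof -
    have "int (psize (l (j + i * m))) - int (psize (l (j + 1 + i * m))) - of_bool (is_over (l (j + i * m))) = 0" for i
    proof -
      have "\<not> m dvd j + i * m" using j by (auto simp: dvd_add_left_iff dest: dvd_imp_le)
      then have "int (psize (l (j + i * m))) - int (psize (l (j + i * m + 1))) = of_bool (is_over (l (j + i * m)))"
        using assms(1) j by (simp add: Fbar_def)
      then show ?thesis by simp
    qed
    then show ?thesis by (simp only: rho_def Sum_any.neutral)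
  qed
  moreover have "{1..m} = insert m {1..<m}" using assms(2) by auto
  ultimately show ?thesis
    by (simp add: term_F_def term_Pbar_def ac_simps)
qed

theorem theorem1p16:
  fixes m :: nat and s :: "nat \<Rightarrow> 'a::comm_monoid_add"
  assumes "m \<ge> 1"
    and "\<forall>i\<ge>1. s (i + m) = s i"
  shows "(fsummable (Pbar m) (term_Pbar m s) \<longrightarrow>
           (\<exists>N D. has_qpochs (map (\<lambda>j. - (colbar j * qpow (psum s j))) [1..<m + 1]) (psum s m) N \<and>
                  has_qpochs (map (\<lambda>j. col j * qpow (psum s j)) [1..<m]) (psum s m) D \<and>
                  has_fquot N D (fsum (Pbar m) (term_Pbar m s)))) \<and>
         (fsummable (Pset m) (term_P m s) \<longrightarrow>
           (\<exists>D. has_qpochs (map (\<lambda>j. col j * qpow (psum s j)) [1..<m]) (psum s m) D \<and>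
                has_fquot fone D (fsum (Pset m) (term_P m s)))) \<and>
         (fsummable (Fbar m) (term_F m s) \<longrightarrow>
           has_qpochs (map (\<lambda>j. - (colbar j * qpow (psum s j))) [1..<m + 1]) (psum s m)
             (fsum (Fbar m) (term_F m s)))"
proof -
  note m = assms(1) and s = assms(2)
  obtain \<theta> where \<theta>: "bij_betw \<theta> (Pbar m) (regular_omsets m)"
    and tm: "\<And>l. l \<in> Pbar m \<Longrightarrow> term_Pbar m s l = Poly_Mapping.single (mset_mon m s (\<theta> l)) 1"
    and P: "\<And>l. l \<in> Pbar m \<Longrightarrow> l \<in> Pset m \<longleftrightarrow> set_mset (\<theta> l) \<subseteq> num_letters m"
    and F: "\<And>l. l \<in> Pbar m \<Longrightarrow> l \<in> Fbar m \<longleftrightarrow> set_mset (\<theta> l) \<subseteq> over_letters"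
    using ex_Pbar_bij[OF m s] by metis
  have Psub: "Pset m = {l \<in> Pbar m. l \<in> Pset m}" and Fsub: "Fbar m = {l \<in> Pbar m. l \<in> Fbar m}"
    by (auto simp: Pset_def Fbar_def)
  have \<theta>P: "bij_betw \<theta> (Pset m) {X \<in> regular_omsets m. set_mset X \<subseteq> num_letters m}"
    by (subst Psub) (rule bij_betw_Collect[OF \<theta>], rule P)
  have \<theta>F: "bij_betw \<theta> (Fbar m) {X \<in> regular_omsets m. set_mset X \<subseteq> over_letters}"
    by (subst Fsub) (rule bij_betw_Collect[OF \<theta>], rule F)
  have tP: "term_P m s l = Poly_Mapping.single (mset_mon m s (\<theta> l)) 1" if "l \<in> Pset m" for l
    using term_P_eq_term_Pbar[OF that m, of s] tm[of l] that by (simp add: Pset_def)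
  have tF: "term_F m s l = Poly_Mapping.single (mset_mon m s (\<theta> l)) 1" if "l \<in> Fbar m" for l
    using term_F_eq_term_Pbar[OF that m, of s] tm[of l] that by (simp add: Fbar_def)
  have sum_Pbar:
    "fsummable (Pbar m) (term_Pbar m s) \<longleftrightarrow> (\<forall>t. finite {X \<in> regular_omsets m. mset_mon m s X = t})"
    "fsum (Pbar m) (term_Pbar m s) = push (mset_mon m s) (\<lambda>X. of_bool (X \<in> regular_omsets m))"
    by (rule fsum_eq_push[OF \<theta>]; erule tm)+
  have sum_P:
    "fsummable (Pset m) (term_P m s) \<longleftrightarrow> (\<forall>t. finite {X \<in> {X \<in> regular_omsets m. set_mset X \<subseteq> num_letters m}. mset_mon m s X = t})"
    "fsum (Pset m) (term_P m s) = push (mset_mon m s) (\<lambda>X. of_bool (X \<in> {X \<in> regular_omsets m. set_mset X \<subseteq> num_letters m}))"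
    by (rule fsum_eq_push[OF \<theta>P]; erule tP)+
  have sum_F:
    "fsummable (Fbar m) (term_F m s) \<longleftrightarrow> (\<forall>t. finite {X \<in> {X \<in> regular_omsets m. set_mset X \<subseteq> over_letters}. mset_mon m s X = t})"
    "fsum (Fbar m) (term_F m s) = push (mset_mon m s) (\<lambda>X. of_bool (X \<in> {X \<in> regular_omsets m. set_mset X \<subseteq> over_letters}))"
    by (rule fsum_eq_push[OF \<theta>F]; erule tF)+
  let ?push = "push (mset_mon m s)"
  show ?thesis
  proof (intro conjI impI)
    assume "fsummable (Pbar m) (term_Pbar m s)"
    then have fin: "finite {X \<in> regular_omsets m. mset_mon m s X = t}" for t
      unfolding sum_Pbar(1) by (simp del: split_paired_All)
    \<comment> \<open>Summability has become finiteness of the fibres on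
      \<open>regular_omsets\<close>; the supports of numerator and denominator are subfamilies and
      inherit it.\<close>
    have finO: "finite {X \<in> regular_omsets m. set_mset X \<subseteq> over_letters \<and> mset_mon m s X = t}" for t
      by (rule finite_subset[OF _ fin[of t]]) auto
    have finN: "finite {X \<in> regular_omsets m. set_mset X \<subseteq> num_letters m \<and> mset_mon m s X = t}" for t
      by (rule finite_subset[OF _ fin[of t]]) auto
    have "has_fquot (?push (set_weight over_letters 1)) (?push (set_weight (num_letters m) (-1)))
        (fsum (Pbar m) (term_Pbar m s))"
      unfolding has_fquot_def sum_Pbar(2)
      using has_fprod_inverse[OF finN] has_fprod_over_num[OF fin] by blast
    then show "\<exists>N D. has_qpochs (map (\<lambda>j. - (colbar j * qpow (psum s j))) [1..<m + 1]) (psum s m) N \<and>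
        has_qpochs (map (\<lambda>j. col j * qpow (psum s j)) [1..<m]) (psum s m) D \<and>
        has_fquot N D (fsum (Pbar m) (term_Pbar m s))"
      using has_qpochs_over[OF m s finO] has_qpochs_num[OF m s finN] by blast
  next
    assume "fsummable (Pset m) (term_P m s)"
    then have finN: "finite {X \<in> regular_omsets m. set_mset X \<subseteq> num_letters m \<and> mset_mon m s X = t}" for t
      unfolding sum_P(1) by (simp del: split_paired_All)
    have "(\<lambda>X. of_bool (X \<in> {X \<in> regular_omsets m. set_mset X \<subseteq> num_letters m})) = mset_weight (num_letters m)"
      using num_multisets_regular[of _ m] by (auto simp: mset_weight_def fun_eq_iff)
    then have "has_fquot fone (?push (set_weight (num_letters m) (-1))) (fsum (Pset m) (term_P m s))"
      unfolding has_fquot_def sum_P(2)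
      using has_fprod_inverse[OF finN] has_fprod_fone_num[OF finN] by auto
    then show "\<exists>D. has_qpochs (map (\<lambda>j. col j * qpow (psum s j)) [1..<m]) (psum s m) D \<and>
        has_fquot fone D (fsum (Pset m) (term_P m s))"
      using has_qpochs_num[OF m s finN] by blast
  next
    assume "fsummable (Fbar m) (term_F m s)"
    then have finO: "finite {X \<in> regular_omsets m. set_mset X \<subseteq> over_letters \<and> mset_mon m s X = t}" for t
      unfolding sum_F(1) by (simp del: split_paired_All)
    \<comment> \<open>Without non-over-lined parts a regular multiset is a set of over-lined parts,
      so the left-hand side is already the expanded product.\<close>
    have "of_bool (X \<in> {X \<in> regular_omsets m. set_mset X \<subseteq> over_letters}) = set_weight over_letters 1 X" for X
    proof -
      have "count X p \<le> 1" if "X \<in> regular_omsets m" "set_mset X \<subseteq> over_letters" for p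
        using that by (cases "p \<in># X") (auto simp: regular_omsets_iff not_in_iff)
      then show ?thesis by (auto simp: set_weight_def regular_omsets_iff)
    qed
    then show "has_qpochs (map (\<lambda>j. - (colbar j * qpow (psum s j))) [1..<m + 1]) (psum s m)
        (fsum (Fbar m) (term_F m s))"
      unfolding sum_F(2) using has_qpochs_over[OF m s finO] by simp
  qed
qed

end
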